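(* Consider the distributionally robust optimization problem $$\text{(DRO)}\qquad \min_{x\in X} f(x)\quad\text{s.t.}\quad \inf_{\mu\in\mathcal{M}}\mathbb{E}_\mu[h(x,\xi)]\ge 0$$ and the Moment-SOS algorithm described in the context. Assume $K^*=\mathscr{P}_d(S)+Y^*$ and that the primal-dual pair $(P_k)$–$(D_k)$ (defined in the context) has no duality gap, i.e. $f_k=\gamma_k$. Suppose $f,-c_1,\dots,-c_m$ are all SOS-convex and $x\mapsto\mathbb{E}_\mu[h(x,\xi)]$ is SOS-concave for every $\mu\in\mathcal{M}$. If the algorithm terminates at some loop of order $k$, then its output $x^*$ is a global optimizer of (DRO).
   Context: Variables: $x=(x_1,\dots,x_n)$ (decision) and $\xi=(\xi_1,\dots,\xi_p)$ (random). For $u\in\{x,\xi\}$ of dimension $l$, $\mathbb{N}^l_e=\{\alpha\in\mathbb{N}^l:|\alpha|\le e\}$, $[u]_e=(u^\alpha)_{\alpha\in\mathbb{N}^l_e}$ is the monomial vector, $\mathbb{R}[u]_e$ is the space of real polynomials in $u$ of degree at most $e$, and $\Sigma[u]_e$ is the set of sums of squares of polynomials that have degree at most $e$. For $q=\sum_\alpha q_\alpha u^\alpha\in\mathbb{R}[u]_e$ and $y\in\mathbb{R}^{\mathbb{N}^l_e}$, $\langle q,y\rangle=\sum_\alpha q_\alpha y_\alpha$. Data: $f\in\mathbb{R}[x]$, $h(x,\xi)\in\mathbb{R}[x,\xi]$, $X=\{x\in\mathbb{R}^n: c_1(x)\ge0,\dots,c_m(x)\ge 0\}$ with $c=(c_1,\dots,c_m)$,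 $c_i\in\mathbb{R}[x]$; $g=(g_1,\dots,g_{m_1})$ with $g_i\in\mathbb{R}[\xi]$, and $S=\{\xi\in\mathbb{R}^p: g_1(\xi)\ge0,\dots,g_{m_1}(\xi)\ge0\}$. Let $d$ be the degree of $h$ in $\xi$. The set $Y\subseteq\mathbb{R}^{\mathbb{N}^p_d}$ is given by linear, second-order cone and semidefinite constraints. The moment ambiguity set $\mathcal{M}$ is the set of (nonnegative) Borel measures $\mu$ on $\mathbb{R}^p$ with $\mathrm{supp}(\mu)\subseteq S$ and $\mathbb{E}_\mu([\xi]_d)\in Y$, where $\mathbb{E}_\mu$ denotes integration with respect to $\mu$. For a tuple of polynomials, $\deg$ is the maximum of the degrees. Let $t=\max\{\lceil \deg_x(h)/2\rceil,\lceil\deg(f)/2\rceil,\lceil\deg(c)/2\rceil\}$ ($\deg_x$ is the degree in $x$), $d_0=\max\{\lceil d/2\rceil,\lceil\deg(g)/2\rceil\}$, $d_2=\lceil\deg(g)/2\rceil$. Write $h(x,\xi)=\sum_{\beta\in\mathbb{N}^p_d}h_\beta(x)\xi^\beta$; $H$ is the unique real matrix with $(h_\beta(x))_{\beta\in\mathbb{N}^p_d}=H[x]_{2t}$. Cones: $cone(\cdot)$ is the conic hull. $K=cone(\{\mathbb{E}_\mu([\xi]_d):\mu\in\mathcal{M}\})$. For $T\subseteq\mathbb{R}^{\mathbb{N}^p_d}$, $T^*=\{q\in\mathbb{R}[\xi]_d:\langle q,y\rangle\ge0\ \forall y\in T\}$. $\mathscr{P}_d(S)=\{q\in\mathbb{R}[\xi]_d: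 q\ge 0\text{ on }S\}$. The truncated quadratic module is $\mathrm{QM}[g]_{2k}=\Sigma[\xi]_{2k}+g_1\Sigma[\xi]_{2k-\deg(g_1)}+\cdots+g_{m_1}\Sigma[\xi]_{2k-\deg(g_{m_1})}$, and $\mathrm{QM}[c]_{2t}$ is defined in the same way in the variable $x$. For $w\in\mathbb{R}^{\mathbb{N}^l_{2k}}$ and $q\in\mathbb{R}[u]_{2k}$, the localizing matrix $L_q^{(k)}[w]$ is the symmetric matrix with $vec(b_1)^T L_q^{(k)}[w]\,vec(b_2)=\langle q b_1b_2,w\rangle$ for all $b_1,b_2\in\mathbb{R}[u]_s$, $s=k-\lceil\deg(q)/2\rceil$, where $vec(b)$ is the coefficient vector of $b$. The moment matrix is $M_k[w]=L_1^{(k)}[w]=(w_{\alpha+\beta})_{\alpha,\beta\in\mathbb{N}^l_k}$. For $w\in\mathbb{R}^{\mathbb{N}^n_{2t}}$, $w_0$ is the entry indexed by $0$ and $\pi(w)=(w_{e_1},\dots,w_{e_n})$. $z|_d=(z_\alpha)_{\alpha\in\mathbb{N}^p_d}$ is the degree-$d$ truncation. A polynomial $\psi\in\mathbb{R}[x]$ is SOS-convex if $\nabla^2\psi(x)=L(x)L(x)^T$ for some matrix polynomial $L(x)$; it is SOS-concave if $-\psi$ is SOS-convex. Relaxations of order $k\ge d_0$: $$(P_k)\quad f_k:=\min_w \langle f,w\rangle\ \text{ s.t. }\ (Hw)^T[\xi]_d\in(\mathrm{QM}[g]_{2k}\cap\mathbb{R}[\xi]_d)+Y^*,\ L^{(t)}_{c_i}[w]\succeq0\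 (i=1,\dots,m),\ M_t[w]\succeq0,\ w_0=1,\ w\in\mathbb{R}^{\mathbb{N}^n_{2t}};$$ $$(D_k)\quad \gamma_k:=\max_{(\gamma,y,z)}\gamma\ \text{ s.t. }\ f(x)-y^TH[x]_{2t}-\gamma\in\mathrm{QM}[c]_{2t},\ \gamma\in\mathbb{R},\ y\in cone(Y),\ y=z|_d,\ M_k[z]\succeq0,\ L^{(k)}_{g_i}[z]\succeq0\ (i=1,\dots,m_1),\ z\in\mathbb{R}^{\mathbb{N}^p_{2k}}.$$ Algorithm. Initialize $k:=d_0$, $k_1:=\lceil(d+1)/2\rceil$. Step 0: Formulate $cone(Y)$ and select a generic $R\in\Sigma[\xi]_{2k_1}$. Step 1: Solve $(P_k)$ and $(D_k)$ for optimizers $w^*$ and $(\gamma^*,y^*,z^* )$ respectively. Step 2: Solve the moment problem: minimize $\langle R,\hat z\rangle$ over $\hat z\in\mathbb{R}^{\mathbb{N}^p_{2k_1}}$ subject to $L^{(k_1)}_{g_i}[\hat z]\succeq0$ $(i=1,\dots,m_1)$, $M_{k_1}[\hat z]\succeq0$, $\hat z|_d=y^*$. If it is infeasible, set $k:=k+1$ and go back to Step 1; if it is feasible, solve it for an optimizer $\hat z^*$ and go to Step 3. Step 3: Check whether there is an integer $d_1\in[d_0,k_1]$ with $\mathrm{rank}\,M_{d_1}[\hat z^*]=\mathrm{rank}\,M_{d_1-d_2}[\hat z^*]$. If so, go to Step 4; otherwise set $k_1:=k_1+1$ and go back to Step 2. Step 4: Output $x^*=\pi(w^* )$ and terminate.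
   Formalization: In Step 3 the number $d_2$ is taken as $\max\{1,\lceil\deg(g)/2\rceil\}$ and $d_1\ge d_2$ is required; this differs only when all $g_i$ are constant or $g$ is empty, where the rank test would be void and the claim is false. *)

theory Defs
  imports "HOL-Analysis.Analysis" "HOL-Analysis.Finite_Function_Topology"
begin

section \<open>Polynomials\<close>

text \<open>
  Real polynomials in the variables \<open>'v\<close> are finitely supported coefficient families on
  exponents; multiplication of \<open>poly_mapping\<close> is convolution, hence the polynomial product.
  Vectors of \<open>\<real>\<^sup>N\<close>, \<open>N = {\<alpha>. mdeg \<alpha> \<le> e}\<close>, are the elements of the same type that vanish
  outside \<open>N\<close>, so that the library's real vector space structure on \<open>poly_mapping\<close> is available
  for hulls and dimensions.
\<close>

type_synonym 'v mono = "'v \<Rightarrow>\<^sub>0 nat"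
type_synonym 'v rpoly = "'v mono \<Rightarrow>\<^sub>0 real"
type_synonym 'v tms = "'v mono \<Rightarrow>\<^sub>0 real"

definition mdeg :: "'v::finite mono \<Rightarrow> nat" where
  "mdeg \<alpha> = (\<Sum>i\<in>UNIV. Poly_Mapping.lookup \<alpha> i)"

definition expnts :: "nat \<Rightarrow> 'v::finite mono set" where
  "expnts e = {\<alpha>. mdeg \<alpha> \<le> e}"

text \<open>The zero polynomial and the empty tuple have degree 0.\<close>

definition pdeg :: "'v::finite rpoly \<Rightarrow> nat" where
  "pdeg q = Max (insert 0 (mdeg ` Poly_Mapping.keys q))"

definition tdeg :: "'v::finite rpoly list \<Rightarrow> nat" where
  "tdeg qs = Max (insert 0 (pdeg ` set qs))"

definition polys :: "nat \<Rightarrow> 'v::finite rpoly set" where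
  "polys e = {q. pdeg q \<le> e}"

definition tms_space :: "nat \<Rightarrow> 'v::finite tms set" where
  "tms_space e = {y. Poly_Mapping.keys y \<subseteq> expnts e}"

abbreviation monom :: "'v mono \<Rightarrow> real \<Rightarrow> 'v rpoly" where
  "monom \<equiv> Poly_Mapping.single"

definition mval :: "'v::finite mono \<Rightarrow> ('v \<Rightarrow> real) \<Rightarrow> real" where
  "mval \<alpha> v = (\<Prod>i\<in>UNIV. v i ^ Poly_Mapping.lookup \<alpha> i)"

definition peval :: "'v::finite rpoly \<Rightarrow> ('v \<Rightarrow> real) \<Rightarrow> real" where
  "peval q v = (\<Sum>\<alpha>\<in>Poly_Mapping.keys q. Poly_Mapping.lookup q \<alpha> * mval \<alpha> v)"

definition pairing :: "'v::finite rpoly \<Rightarrow> 'v tms \<Rightarrow> real" where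
  "pairing q y = (\<Sum>\<alpha>\<in>Poly_Mapping.keys q. Poly_Mapping.lookup q \<alpha> * Poly_Mapping.lookup y \<alpha>)"

text \<open>\<open>half_up e\<close> is \<open>e / 2\<close> rounded up.\<close>

definition half_up :: "nat \<Rightarrow> nat" where
  "half_up e = (e + 1) div 2"

definition pderivative :: "'v \<Rightarrow> 'v rpoly \<Rightarrow> 'v rpoly" where
  "pderivative i q = (\<Sum>\<alpha>\<in>Poly_Mapping.keys q.
     monom (\<alpha> - Poly_Mapping.single i 1)
       (real (Poly_Mapping.lookup \<alpha> i) * Poly_Mapping.lookup q \<alpha>))"

text \<open>The Hessian equals \<open>L L\<^sup>T\<close> for a matrix polynomial \<open>L\<close> with \<open>r\<close> columns.\<close>

definition sos_convex :: "'v::finite rpoly \<Rightarrow> bool" where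
  "sos_convex \<psi> \<longleftrightarrow> (\<exists>(r::nat) (L :: 'v \<Rightarrow> nat \<Rightarrow> 'v rpoly).
     \<forall>i j. pderivative i (pderivative j \<psi>) = (\<Sum>l<r. L i l * L j l))"

definition sos_concave :: "'v::finite rpoly \<Rightarrow> bool" where
  "sos_concave \<psi> \<longleftrightarrow> sos_convex (- \<psi>)"

definition sos_concave_fun :: "(real^'n \<Rightarrow> real) \<Rightarrow> bool" where
  "sos_concave_fun F \<longleftrightarrow> (\<exists>\<psi>. (\<forall>x. F x = peval \<psi> (($) x)) \<and> sos_concave \<psi>)"

definition sos :: "nat \<Rightarrow> 'v::finite rpoly set" where
  "sos e = {p. pdeg p \<le> e \<and> (\<exists>qs. p = sum_list (map (\<lambda>q. q * q) qs))}"

text \<open>Only used with \<open>pdeg (g ! i) \<le> e\<close> for all \<open>i\<close>, so the subtraction does not truncate.\<close>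

definition QM :: "'v::finite rpoly list \<Rightarrow> nat \<Rightarrow> 'v rpoly set" where
  "QM g e = {\<sigma>\<^sub>0 + (\<Sum>i<length g. g ! i * \<sigma> i) | \<sigma>\<^sub>0 \<sigma>.
     \<sigma>\<^sub>0 \<in> sos e \<and> (\<forall>i<length g. \<sigma> i \<in> sos (e - pdeg (g ! i)))}"

definition semialg :: "'v::finite rpoly list \<Rightarrow> (real^'v) set" where
  "semialg g = {v. \<forall>q\<in>set g. peval q (($) v) \<ge> 0}"


section \<open>Moment and localizing matrices\<close>

definition psd_on :: "'i set \<Rightarrow> ('i \<Rightarrow> 'i \<Rightarrow> real) \<Rightarrow> bool" where
  "psd_on I A \<longleftrightarrow> (\<forall>i\<in>I. \<forall>j\<in>I. A i j = A j i) \<and>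
     (\<forall>v. (\<Sum>i\<in>I. \<Sum>j\<in>I. v i * A i j * v j) \<ge> 0)"

definition rank_on :: "'i set \<Rightarrow> ('i \<Rightarrow> 'i \<Rightarrow> real) \<Rightarrow> nat" where
  "rank_on I A = dim ((\<lambda>j. \<Sum>i\<in>I. Poly_Mapping.single i (A i j)) ` I)"

text \<open>
  \<open>loc_idx q k\<close> is the set of exponents of degree at most \<open>k - half_up (pdeg q)\<close>; it is empty, and
  the localizing matrix a matrix of size 0, if this number is negative.
\<close>

definition loc_idx :: "'v::finite rpoly \<Rightarrow> nat \<Rightarrow> 'v mono set" where
  "loc_idx q k = {\<alpha>. mdeg \<alpha> + half_up (pdeg q) \<le> k}"

definition loc_entry :: "'v::finite rpoly \<Rightarrow> 'v tms \<Rightarrow> 'v mono \<Rightarrow> 'v mono \<Rightarrow> real" where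
  "loc_entry q w \<alpha> \<beta> = pairing (q * monom \<alpha> 1 * monom \<beta> 1) w"

definition loc_psd :: "'v::finite rpoly \<Rightarrow> nat \<Rightarrow> 'v tms \<Rightarrow> bool" where
  "loc_psd q k w \<longleftrightarrow> psd_on (loc_idx q k) (loc_entry q w)"

definition mom_psd :: "nat \<Rightarrow> 'v::finite tms \<Rightarrow> bool" where
  "mom_psd k w \<longleftrightarrow> loc_psd 1 k w"

definition mom_rank :: "nat \<Rightarrow> 'v::finite tms \<Rightarrow> nat" where
  "mom_rank k w = rank_on (loc_idx 1 k) (loc_entry 1 w)"

definition trunc :: "nat \<Rightarrow> 'v::finite tms \<Rightarrow> 'v tms" where
  "trunc e z = (\<Sum>\<alpha>\<in>expnts e. Poly_Mapping.single \<alpha> (Poly_Mapping.lookup z \<alpha>))"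

definition first_moments :: "'n::finite tms \<Rightarrow> real^'n" where
  "first_moments w = (\<chi> i. Poly_Mapping.lookup w (Poly_Mapping.single i 1))"


section \<open>The function \<open>h\<close>\<close>

text \<open>
  \<open>h\<close> is a polynomial in the variables \<open>'n + 'p\<close>: \<open>Inl\<close> marks the decision variables and
  \<open>Inr\<close> the random ones.
\<close>

definition degx :: "('n::finite + 'p::finite) rpoly \<Rightarrow> nat" where
  "degx h = Max (insert 0 ((\<lambda>m. \<Sum>i\<in>UNIV. Poly_Mapping.lookup m (Inl i)) ` Poly_Mapping.keys h))"

definition degxi :: "('n::finite + 'p::finite) rpoly \<Rightarrow> nat" where
  "degxi h = Max (insert 0 ((\<lambda>m. \<Sum>j\<in>UNIV. Poly_Mapping.lookup m (Inr j)) ` Poly_Mapping.keys h))"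

definition hval :: "('n::finite + 'p::finite) rpoly \<Rightarrow> real^'n \<Rightarrow> real^'p \<Rightarrow> real" where
  "hval h x \<xi> = peval h (case_sum (($) x) (($) \<xi>))"

definition join :: "'n::finite mono \<Rightarrow> 'p::finite mono \<Rightarrow> ('n + 'p) mono" where
  "join \<alpha> \<beta> = (\<Sum>i\<in>UNIV. Poly_Mapping.single (Inl i) (Poly_Mapping.lookup \<alpha> i))
            + (\<Sum>j\<in>UNIV. Poly_Mapping.single (Inr j) (Poly_Mapping.lookup \<beta> j))"

text \<open>
  The entry of \<open>H\<close> in row \<open>\<beta>\<close> and column \<open>\<alpha>\<close>: the coefficient of \<open>x\<^sup>\<alpha>\<close> in \<open>h\<^sub>\<beta>(x)\<close>, that is, of
  \<open>x\<^sup>\<alpha> \<xi>\<^sup>\<beta>\<close> in \<open>h\<close>.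
\<close>

definition Hmat :: "('n::finite + 'p::finite) rpoly \<Rightarrow> 'p mono \<Rightarrow> 'n mono \<Rightarrow> real" where
  "Hmat h \<beta> \<alpha> = Poly_Mapping.lookup h (join \<alpha> \<beta>)"

text \<open>The polynomials \<open>(Hw)\<^sup>T[\<xi>]\<^sub>d\<close> and \<open>y\<^sup>TH[x]\<^sub>e\<close>, where \<open>d = degxi h\<close>.\<close>

definition Hw_poly :: "('n::finite + 'p::finite) rpoly \<Rightarrow> nat \<Rightarrow> 'n tms \<Rightarrow> 'p rpoly" where
  "Hw_poly h e w = (\<Sum>\<beta>\<in>expnts (degxi h).
     monom \<beta> (\<Sum>\<alpha>\<in>expnts e. Hmat h \<beta> \<alpha> * Poly_Mapping.lookup w \<alpha>))"

definition yH_poly :: "('n::finite + 'p::finite) rpoly \<Rightarrow> nat \<Rightarrow> 'p tms \<Rightarrow> 'n rpoly" where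
  "yH_poly h e y = (\<Sum>\<alpha>\<in>expnts e.
     monom \<alpha> (\<Sum>\<beta>\<in>expnts (degxi h). Poly_Mapping.lookup y \<beta> * Hmat h \<beta> \<alpha>))"


section \<open>The ambiguity set and its cones\<close>

text \<open>An affine function on moment vectors is a pair \<open>(q, b)\<close>, standing for \<open>y \<mapsto> \<langle>q, y\<rangle> + b\<close>.\<close>

type_synonym 'v affine_fun = "'v rpoly \<times> real"

definition aff_val :: "'v::finite affine_fun \<Rightarrow> 'v tms \<Rightarrow> real" where
  "aff_val l y = pairing (fst l) y + snd l"

datatype 'v conic_constraint =
    Lin_eq "'v affine_fun"
  | Lin_ge "'v affine_fun"
  | Soc "'v affine_fun list" "'v affine_fun"
  | Semidef nat "nat \<Rightarrow> nat \<Rightarrow> 'v affine_fun"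

fun satisfies :: "'v::finite tms \<Rightarrow> 'v conic_constraint \<Rightarrow> bool" where
  "satisfies y (Lin_eq l) \<longleftrightarrow> aff_val l y = 0"
| "satisfies y (Lin_ge l) \<longleftrightarrow> aff_val l y \<ge> 0"
| "satisfies y (Soc ls r) \<longleftrightarrow> sqrt (\<Sum>l\<leftarrow>ls. (aff_val l y)\<^sup>2) \<le> aff_val r y"
| "satisfies y (Semidef N A) \<longleftrightarrow> psd_on {..<N} (\<lambda>i j. aff_val (A i j) y)"

definition conic_described :: "nat \<Rightarrow> 'v::finite tms set \<Rightarrow> bool" where
  "conic_described e Y \<longleftrightarrow> (\<exists>Cs. Y = {y \<in> tms_space e. \<forall>C\<in>set Cs. satisfies y C})"

definition msupport :: "'a::topological_space measure \<Rightarrow> 'a set" where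
  "msupport \<mu> = {a. \<forall>U. open U \<and> a \<in> U \<longrightarrow> emeasure \<mu> U > 0}"

definition moment_vector :: "nat \<Rightarrow> (real^'p) measure \<Rightarrow> 'p tms" where
  "moment_vector e \<mu> = (\<Sum>\<beta>\<in>expnts e. Poly_Mapping.single \<beta> (\<integral>\<xi>. mval \<beta> (($) \<xi>) \<partial>\<mu>))"

text \<open>
  Existence of the moments up to order \<open>e\<close> is part of membership, because the Bochner integral
  of a non-integrable function is 0. Order 0 makes the measures finite.
\<close>

definition ambiguity ::
    "'p::finite rpoly list \<Rightarrow> nat \<Rightarrow> 'p tms set \<Rightarrow> (real^'p) measure set" where
  "ambiguity g e Y = {\<mu>. sets \<mu> = sets borel \<and> msupport \<mu> \<subseteq> semialg g \<and>
     (\<forall>\<beta>\<in>expnts e. integrable \<mu> (\<lambda>\<xi>. mval \<beta> (($) \<xi>))) \<and> moment_vector e \<mu> \<in> Y}"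

definition K_cone :: "'p::finite rpoly list \<Rightarrow> nat \<Rightarrow> 'p tms set \<Rightarrow> 'p tms set" where
  "K_cone g e Y = convex_cone hull (moment_vector e ` ambiguity g e Y)"

definition dual_cone :: "nat \<Rightarrow> 'v::finite tms set \<Rightarrow> 'v rpoly set" where
  "dual_cone e T = {q \<in> polys e. \<forall>y\<in>T. pairing q y \<ge> 0}"

definition nonneg_polys :: "nat \<Rightarrow> (real^'v::finite) set \<Rightarrow> 'v rpoly set" where
  "nonneg_polys e S = {q \<in> polys e. \<forall>v\<in>S. peval q (($) v) \<ge> 0}"


section \<open>The problem and its relaxations\<close>

definition dro_feasible ::
    "('n::finite + 'p::finite) rpoly \<Rightarrow> 'n rpoly list \<Rightarrow> 'p rpoly list \<Rightarrow> 'p tms set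
      \<Rightarrow> (real^'n) set" where
  "dro_feasible h c g Y = {x \<in> semialg c.
     (INF \<mu>\<in>ambiguity g (degxi h) Y. ereal (\<integral>\<xi>. hval h x \<xi> \<partial>\<mu>)) \<ge> 0}"

definition dro_optimizer ::
    "'n::finite rpoly \<Rightarrow> ('n + 'p::finite) rpoly \<Rightarrow> 'n rpoly list \<Rightarrow> 'p rpoly list \<Rightarrow> 'p tms set
      \<Rightarrow> real^'n \<Rightarrow> bool" where
  "dro_optimizer f h c g Y x \<longleftrightarrow> x \<in> dro_feasible h c g Y \<and>
     (\<forall>x'\<in>dro_feasible h c g Y. peval f (($) x) \<le> peval f (($) x'))"

definition ord_t ::
    "'n::finite rpoly \<Rightarrow> ('n + 'p::finite) rpoly \<Rightarrow> 'n rpoly list \<Rightarrow> nat" where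
  "ord_t f h c = Max {half_up (degx h), half_up (pdeg f), half_up (tdeg c)}"

definition ord_d0 :: "('n::finite + 'p::finite) rpoly \<Rightarrow> 'p rpoly list \<Rightarrow> nat" where
  "ord_d0 h g = max (half_up (degxi h)) (half_up (tdeg g))"

text \<open>
  The rank condition below compares moment matrices of the orders \<open>d\<^sub>1\<close> and \<open>d\<^sub>1 - d\<^sub>2\<close>. The lower
  bound 1 (customary for flat truncation) matters only if all \<open>g\<^sub>i\<close> are constant or the tuple is
  empty: then \<open>half_up (tdeg g) = 0\<close>, both orders would coincide, and the condition would hold
  for every vector, with or without a representing measure.
\<close>

definition ord_d2 :: "'p::finite rpoly list \<Rightarrow> nat" where
  "ord_d2 g = max 1 (half_up (tdeg g))"

definition primal_feasible ::
    "'n::finite rpoly \<Rightarrow> ('n + 'p::finite) rpoly \<Rightarrow> 'n rpoly list \<Rightarrow> 'p rpoly list \<Rightarrow> 'p tms set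
      \<Rightarrow> nat \<Rightarrow> 'n tms set" where
  "primal_feasible f h c g Y k = (let d = degxi h; t = ord_t f h c in
     {w \<in> tms_space (2 * t).
        Hw_poly h (2 * t) w \<in> (QM g (2 * k) \<inter> polys d) + dual_cone d Y \<and>
        (\<forall>q\<in>set c. loc_psd q t w) \<and> mom_psd t w \<and> Poly_Mapping.lookup w 0 = 1})"

definition dual_feasible ::
    "'n::finite rpoly \<Rightarrow> ('n + 'p::finite) rpoly \<Rightarrow> 'n rpoly list \<Rightarrow> 'p rpoly list \<Rightarrow> 'p tms set
      \<Rightarrow> nat \<Rightarrow> (real \<times> 'p tms \<times> 'p tms) set" where
  "dual_feasible f h c g Y k = (let d = degxi h; t = ord_t f h c in
     {(\<gamma>, y, z). f - yH_poly h (2 * t) y - monom 0 \<gamma> \<in> QM c (2 * t) \<and>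
        y \<in> convex_cone hull Y \<and> z \<in> tms_space (2 * k) \<and> y = trunc d z \<and>
        mom_psd k z \<and> (\<forall>q\<in>set g. loc_psd q k z)})"

definition primal_value ::
    "'n::finite rpoly \<Rightarrow> ('n + 'p::finite) rpoly \<Rightarrow> 'n rpoly list \<Rightarrow> 'p rpoly list \<Rightarrow> 'p tms set
      \<Rightarrow> nat \<Rightarrow> ereal" where
  "primal_value f h c g Y k = (INF w\<in>primal_feasible f h c g Y k. ereal (pairing f w))"

definition dual_value ::
    "'n::finite rpoly \<Rightarrow> ('n + 'p::finite) rpoly \<Rightarrow> 'n rpoly list \<Rightarrow> 'p rpoly list \<Rightarrow> 'p tms set
      \<Rightarrow> nat \<Rightarrow> ereal" where
  "dual_value f h c g Y k = (SUP s\<in>dual_feasible f h c g Y k. ereal (fst s))"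

definition primal_optimizer ::
    "'n::finite rpoly \<Rightarrow> ('n + 'p::finite) rpoly \<Rightarrow> 'n rpoly list \<Rightarrow> 'p rpoly list \<Rightarrow> 'p tms set
      \<Rightarrow> nat \<Rightarrow> 'n tms \<Rightarrow> bool" where
  "primal_optimizer f h c g Y k w \<longleftrightarrow> w \<in> primal_feasible f h c g Y k \<and>
     (\<forall>w'\<in>primal_feasible f h c g Y k. pairing f w \<le> pairing f w')"

definition dual_optimizer ::
    "'n::finite rpoly \<Rightarrow> ('n + 'p::finite) rpoly \<Rightarrow> 'n rpoly list \<Rightarrow> 'p rpoly list \<Rightarrow> 'p tms set
      \<Rightarrow> nat \<Rightarrow> real \<times> 'p tms \<times> 'p tms \<Rightarrow> bool" where
  "dual_optimizer f h c g Y k s \<longleftrightarrow> s \<in> dual_feasible f h c g Y k \<and>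
     (\<forall>s'\<in>dual_feasible f h c g Y k. fst s' \<le> fst s)"

definition ext_feasible ::
    "'p::finite rpoly list \<Rightarrow> nat \<Rightarrow> nat \<Rightarrow> 'p tms \<Rightarrow> 'p tms set" where
  "ext_feasible g d k1 y = {z \<in> tms_space (2 * k1).
     (\<forall>q\<in>set g. loc_psd q k1 z) \<and> mom_psd k1 z \<and> trunc d z = y}"

definition ext_optimizer ::
    "'p::finite rpoly list \<Rightarrow> nat \<Rightarrow> 'p rpoly \<Rightarrow> nat \<Rightarrow> 'p tms \<Rightarrow> 'p tms \<Rightarrow> bool" where
  "ext_optimizer g d R k1 y z \<longleftrightarrow> z \<in> ext_feasible g d k1 y \<and>
     (\<forall>z'\<in>ext_feasible g d k1 y. pairing R z \<le> pairing R z')"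

definition flat ::
    "('n::finite + 'p::finite) rpoly \<Rightarrow> 'p rpoly list \<Rightarrow> nat \<Rightarrow> 'p tms \<Rightarrow> bool" where
  "flat h g k1 z \<longleftrightarrow> (\<exists>d1. ord_d0 h g \<le> d1 \<and> ord_d2 g \<le> d1 \<and> d1 \<le> k1 \<and>
     mom_rank d1 z = mom_rank (d1 - ord_d2 g) z)"


section \<open>The algorithm\<close>

text \<open>
  The algorithm is nondeterministic in the choice of optimizers. A configuration records the
  step about to be executed, the orders \<open>k\<close> and \<open>k\<^sub>1\<close>, and the data still in use: \<open>w\<^sup>*\<close>, then
  \<open>y\<^sup>*\<close>, then the optimizer of the moment problem. \<open>Output k x\<close> means termination in the loop of
  order \<open>k\<close> with output \<open>x\<close>.
\<close>

datatype ('n, 'p) config =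
    Step1 nat nat
  | Step2 nat nat "'n tms" "'p tms"
  | Step3 nat nat "'n tms" "'p tms" "'p tms"
  | Step4 nat "'n tms"
  | Output nat "real^'n"

text \<open>\<open>R\<close> is selected once, with the initial value of \<open>k\<^sub>1\<close>, and kept when \<open>k\<^sub>1\<close> grows.\<close>

definition init_k1 :: "('n::finite + 'p::finite) rpoly \<Rightarrow> nat" where
  "init_k1 h = half_up (degxi h + 1)"

inductive reachable ::
    "'n::finite rpoly \<Rightarrow> ('n + 'p::finite) rpoly \<Rightarrow> 'n rpoly list \<Rightarrow> 'p rpoly list \<Rightarrow> 'p tms set
      \<Rightarrow> 'p rpoly \<Rightarrow> ('n, 'p) config \<Rightarrow> bool"
  for f h c g Y R where
  start: "reachable f h c g Y R (Step1 (ord_d0 h g) (init_k1 h))"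
| solve: "\<lbrakk>reachable f h c g Y R (Step1 k k1);
           primal_optimizer f h c g Y k w; dual_optimizer f h c g Y k (\<gamma>, y, z)\<rbrakk>
          \<Longrightarrow> reachable f h c g Y R (Step2 k k1 w y)"
| infeasible: "\<lbrakk>reachable f h c g Y R (Step2 k k1 w y); ext_feasible g (degxi h) k1 y = {}\<rbrakk>
          \<Longrightarrow> reachable f h c g Y R (Step1 (k + 1) k1)"
| extend: "\<lbrakk>reachable f h c g Y R (Step2 k k1 w y); ext_optimizer g (degxi h) R k1 y z\<rbrakk>
          \<Longrightarrow> reachable f h c g Y R (Step3 k k1 w y z)"
| flat_found: "\<lbrakk>reachable f h c g Y R (Step3 k k1 w y z); flat h g k1 z\<rbrakk>
          \<Longrightarrow> reachable f h c g Y R (Step4 k w)"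
| not_flat: "\<lbrakk>reachable f h c g Y R (Step3 k k1 w y z); \<not> flat h g k1 z\<rbrakk>
          \<Longrightarrow> reachable f h c g Y R (Step2 k (k1 + 1) w y)"
| emit: "reachable f h c g Y R (Step4 k w)
          \<Longrightarrow> reachable f h c g Y R (Output k (first_moments w))"

end

theory Submission
  imports Defs
begin

text \<open>
  Let \<open>w\<close> and \<open>(\<gamma>, y, z)\<close> be the optimizers of the loop in which the algorithm stops, and \<open>x\<^sup>*\<close> the
  vector of first moments of \<open>w\<close>. The claim follows from two facts: \<open>x\<^sup>*\<close> is feasible with
  \<open>f(x\<^sup>*) \<le> \<langle>f, w\<rangle>\<close>, and \<open>\<gamma> \<le> f(x)\<close> for every feasible \<open>x\<close>. As there is no duality gap, \<open>\<langle>f, w\<rangle> = \<gamma>\<close>.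

  The first fact rests on Jensen's inequality for pseudo-moments (\<open>sos_convex_jensen\<close>): an SOS-convex
  polynomial \<open>\<psi>\<close> satisfies \<open>\<psi>(x\<^sup>*) \<le> \<langle>\<psi>, w\<rangle>\<close> as soon as \<open>w\<^sub>0 = 1\<close> and the moment matrix of \<open>w\<close> is
  positive semidefinite and of sufficient order. It applies to \<open>f\<close>, to \<open>-c\<^sub>i\<close>, and to the negative of \<open>x \<mapsto> E\<^sub>\<mu> h(x, \<xi>)\<close>. The
  constraints of the primal relaxation say that \<open>\<langle>c\<^sub>i, w\<rangle> \<ge> 0\<close> and that \<open>\<langle>E\<^sub>\<mu> h, w\<rangle> \<ge> 0\<close>, the latter because
  \<open>(Hw)\<^sup>T[\<xi>]\<close> is a sum of a polynomial that is nonnegative on \<open>S\<close> and one that is nonnegative on \<open>Y\<close>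
  (\<open>first_moments_dro_feasible\<close>).

  The second fact is weak duality (\<open>dual_bound\<close>) and amounts to \<open>\<langle>h(x, \<cdot>), y\<rangle> \<ge> 0\<close>. Feasibility of
  \<open>x\<close> puts \<open>h(x, \<cdot>)\<close> into \<open>K\<^sup>*\<close>, which is the sum of the polynomials nonnegative on \<open>S\<close> and of \<open>Y\<^sup>*\<close>. The
  vector \<open>y\<close> is in the cone of \<open>Y\<close>, and it is nonnegative on the former polynomials since it extends
  to a feasible vector of the moment problem that meets the rank condition. By \<open>flat_truncation\<close> such
  a vector acts, in the degrees that matter, as a nonnegative combination of point evaluations in \<open>S\<close>.

  Flat truncation is proved with multiplication operators. The form \<open>L (p q)\<close> of the associated
  functional \<open>L\<close> is an inner product on the polynomials modulo its kernel. The rank condition says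
  that this quotient is represented in a smaller degree. Thus multiplication by the variables is
  defined on it, and it gives commuting symmetric operators. Their joint spectrum is the set of nodes,
  and an orthonormal basis of common eigenvectors yields the weights (\<open>quadrature\<close>).
\<close>

section \<open>Exponents and polynomials\<close>

abbreviation coef :: "('a \<Rightarrow>\<^sub>0 'b::zero) \<Rightarrow> 'a \<Rightarrow> 'b" where
  "coef \<equiv> Poly_Mapping.lookup"

abbreviation pconst :: "real \<Rightarrow> 'v rpoly" where
  "pconst a \<equiv> monom 0 a"

abbreviation expvar :: "'v \<Rightarrow> 'v mono" where
  "expvar i \<equiv> Poly_Mapping.single i 1"

abbreviation pvar :: "'v \<Rightarrow> 'v rpoly" where
  "pvar i \<equiv> monom (expvar i) 1"

text \<open>Keeps the literal 1 in the exponents \<open>expvar i\<close> from being rewritten to \<open>Suc 0\<close>.\<close>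

declare One_nat_def [simp del]

lemma mdeg_zero [simp]: "mdeg 0 = 0"
  by (simp add: mdeg_def)

lemma mdeg_add: "mdeg (\<alpha> + \<beta>) = mdeg \<alpha> + mdeg \<beta>"
  by (simp add: mdeg_def lookup_add sum.distrib)

lemma mdeg_single [simp]: "mdeg (Poly_Mapping.single i k) = k"
  by (simp add: mdeg_def lookup_single when_def)

lemma mdeg_eq_0_iff: "mdeg \<alpha> = 0 \<longleftrightarrow> \<alpha> = 0"
  by (auto simp: mdeg_def intro: poly_mapping_eqI)

lemma expvar_add_diff: "coef \<alpha> i > 0 \<Longrightarrow> expvar i + (\<alpha> - expvar i) = \<alpha>"
  by (rule poly_mapping_eqI) (auto simp: lookup_add lookup_minus lookup_single when_def)

lemma mono_induct [case_names zero var]: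
  fixes \<alpha> :: "'v::finite mono"
  assumes "P 0" and "\<And>i \<alpha>. P \<alpha> \<Longrightarrow> P (expvar i + \<alpha>)"
  shows "P \<alpha>"
proof (induction "mdeg \<alpha>" arbitrary: \<alpha>)
  case 0
  then have "\<alpha> = 0" by (simp add: mdeg_eq_0_iff)
  then show ?case using assms(1) by simp
next
  case (Suc n)
  have "\<exists>i. coef \<alpha> i > 0"
    using Suc(2) by (metis mdeg_def not_gr_zero sum.neutral nat.distinct(1))
  then obtain i where i: "coef \<alpha> i > 0" by blast
  have "mdeg (expvar i + (\<alpha> - expvar i)) = Suc n"
    using Suc(2) expvar_add_diff[OF i] by simp
  then have "n = mdeg (\<alpha> - expvar i)" by (simp add: mdeg_add)
  from assms(2)[OF Suc(1)[OF this], of i] show ?case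
    by (simp only: expvar_add_diff[OF i])
qed

text \<open>An exponent of bounded degree is determined by its entries, which are bounded as well.\<close>

lemma finite_expnts [simp]: "finite (expnts e :: 'v::finite mono set)"
proof -
  have "coef ` (expnts e :: 'v mono set) \<subseteq> (UNIV::'v set) \<rightarrow>\<^sub>E {..e}"
  proof
    fix f assume "f \<in> coef ` (expnts e :: 'v mono set)"
    then obtain \<alpha> :: "'v mono" where \<alpha>: "f = coef \<alpha>" "mdeg \<alpha> \<le> e"
      by (auto simp: expnts_def)
    have "coef \<alpha> i \<le> mdeg \<alpha>" for i
      unfolding mdeg_def by (rule member_le_sum) auto
    then have "coef \<alpha> i \<le> e" for i using \<alpha>(2) le_trans by blast
    then show "f \<in> UNIV \<rightarrow>\<^sub>E {..e}" using \<alpha>(1) by (auto simp: PiE_def)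
  qed
  then have "finite (coef ` (expnts e :: 'v mono set))"
    by (rule finite_subset) (simp add: finite_PiE)
  then show ?thesis
    by (rule finite_imageD) (simp add: inj_on_def lookup_inject)
qed

lemma expnts_mono: "e \<le> e' \<Longrightarrow> expnts e \<subseteq> expnts e'"
  by (auto simp: expnts_def)

lemma mono_split:
  fixes \<alpha> :: "'v::finite mono"
  assumes "mdeg \<alpha> \<le> a + b"
  obtains \<beta> \<gamma> where "\<alpha> = \<beta> + \<gamma>" "mdeg \<beta> \<le> a" "mdeg \<gamma> \<le> b"
proof -
  have "\<exists>\<beta> \<gamma>. \<alpha> = \<beta> + \<gamma> \<and> mdeg \<beta> \<le> a \<and> mdeg \<gamma> \<le> b"
    using assms
  proof (induction \<alpha> arbitrary: a rule: mono_induct)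
    case zero
    show ?case by (rule exI[of _ 0], rule exI[of _ 0]) simp
  next
    case (var i \<alpha>)
    show ?case
    proof (cases a)
      case 0
      then show ?thesis using var.prems by (intro exI[of _ 0] exI[of _ "expvar i + \<alpha>"]) auto
    next
      case (Suc a')
      have "mdeg \<alpha> \<le> a' + b" using var.prems Suc by (simp add: mdeg_add)
      then have "\<exists>\<beta> \<gamma>. \<alpha> = \<beta> + \<gamma> \<and> mdeg \<beta> \<le> a' \<and> mdeg \<gamma> \<le> b"
        by (rule var.IH)
      then obtain \<beta> \<gamma> where "\<alpha> = \<beta> + \<gamma>" "mdeg \<beta> \<le> a'" "mdeg \<gamma> \<le> b"
        by (elim exE conjE)
      then show ?thesis using Suc
        by (intro exI[of _ "expvar i + \<beta>"] exI[of _ \<gamma>]) (simp add: mdeg_add add.assoc)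
    qed
  qed
  then show thesis using that by blast
qed

lemma rpoly_eq_sum: "p = (\<Sum>\<alpha>\<in>Poly_Mapping.keys p. monom \<alpha> (coef p \<alpha>))"
  by (rule poly_mapping_eqI)
    (simp add: lookup_sum lookup_single when_def in_keys_iff)

lemma rpoly_eq_sum_superset:
  assumes "finite A" "Poly_Mapping.keys p \<subseteq> A"
  shows "p = (\<Sum>\<alpha>\<in>A. monom \<alpha> (coef p \<alpha>))"
  using assms by (intro poly_mapping_eqI)
    (auto simp add: lookup_sum lookup_single when_def in_keys_iff)

lemma rpoly_induct_single [case_names single add]:
  fixes p :: "'v rpoly"
  assumes "\<And>\<alpha> a. P (monom \<alpha> a)" and "\<And>p q. P p \<Longrightarrow> P q \<Longrightarrow> P (p + q)"
  shows "P p"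
proof -
  have "P (\<Sum>\<alpha>\<in>A. monom \<alpha> (coef p \<alpha>))" if "finite A" for A
    using that by (induction A) (use assms(1)[of 0 0] assms in auto)
  from this[OF finite_keys[of p]] show ?thesis by (simp only: rpoly_eq_sum[symmetric])
qed

lemma pvar_mult_monom: "pvar i * monom \<alpha> a = monom (expvar i + \<alpha>) a"
  by (simp add: mult_single)

lemma rpoly_induct [case_names const add var]:
  fixes p :: "'v::finite rpoly"
  assumes "\<And>a. P (pconst a)" and "\<And>p q. P p \<Longrightarrow> P q \<Longrightarrow> P (p + q)"
    and "\<And>i p. P p \<Longrightarrow> P (pvar i * p)"
  shows "P p"
proof (induction p rule: rpoly_induct_single)
  case (single \<alpha> a)
  show ?case
  proof (induction \<alpha> rule: mono_induct)
    case zero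
    show ?case by (rule assms(1))
  next
    case (var i \<alpha>)
    show ?case using assms(3)[OF var, of i] by (simp only: pvar_mult_monom)
  qed
next
  case (add p q)
  then show ?case by (rule assms(2))
qed

lemma lookup_scaleR [simp]: "coef (a *\<^sub>R p) \<alpha> = a *\<^sub>R coef p \<alpha>"
proof -
  have "{i. a *\<^sub>R coef p i \<noteq> 0} \<subseteq> Poly_Mapping.keys p" by (auto simp: in_keys_iff)
  then have "finite {i. a *\<^sub>R coef p i \<noteq> 0}" by (rule finite_subset) simp
  then show ?thesis by (simp add: scaleR_poly_mapping_def)
qed

lemma scaleR_monom: "a *\<^sub>R Poly_Mapping.single \<alpha> b = Poly_Mapping.single \<alpha> (a * b)"
  for b :: real
  by (rule poly_mapping_eqI) (simp add: lookup_single when_def)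

lemma scaleR_eq_pconst_mult: "a *\<^sub>R p = pconst a * p"
  by (induction p rule: rpoly_induct_single)
    (simp_all add: scaleR_monom mult_single scaleR_add_right algebra_simps)

section \<open>Degree, evaluation, pairing and derivatives\<close>

lemma polys_iff: "q \<in> polys e \<longleftrightarrow> Poly_Mapping.keys q \<subseteq> expnts e"
  by (auto simp: polys_def pdeg_def expnts_def)

lemma polysI: "(\<And>\<alpha>. coef q \<alpha> \<noteq> 0 \<Longrightarrow> mdeg \<alpha> \<le> e) \<Longrightarrow> q \<in> polys e"
  by (auto simp: polys_iff expnts_def in_keys_iff)

lemma polysD: "q \<in> polys e \<Longrightarrow> coef q \<alpha> \<noteq> 0 \<Longrightarrow> mdeg \<alpha> \<le> e"
  by (auto simp: polys_iff expnts_def in_keys_iff)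

lemma polys_pdeg: "q \<in> polys (pdeg q)"
  by (simp add: polys_def)

lemma polys_mono: "q \<in> polys e \<Longrightarrow> e \<le> e' \<Longrightarrow> q \<in> polys e'"
  by (simp add: polys_def)

lemma subspace_polys: "subspace (polys e)"
proof (rule subspaceI)
  fix p q :: "'a rpoly" and a :: real
  assume p: "p \<in> polys e" and q: "q \<in> polys e"
  show "p + q \<in> polys e"
  proof (rule polysI)
    fix \<alpha> assume "coef (p + q) \<alpha> \<noteq> 0"
    then have "coef p \<alpha> \<noteq> 0 \<or> coef q \<alpha> \<noteq> 0" by (auto simp: lookup_add)
    then show "mdeg \<alpha> \<le> e" using p q polysD by blast
  qed
next
  fix p :: "'a rpoly" and a :: real
  assume "p \<in> polys e"
  then show "a *\<^sub>R p \<in> polys e" by (auto intro!: polysI dest: polysD)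
qed (auto intro: polysI)

lemma polys_add: "p \<in> polys e \<Longrightarrow> q \<in> polys e \<Longrightarrow> p + q \<in> polys e"
  by (rule subspace_add[OF subspace_polys])

lemma polys_diff: "p \<in> polys e \<Longrightarrow> q \<in> polys e \<Longrightarrow> p - q \<in> polys e"
  by (rule subspace_diff[OF subspace_polys])

lemma polys_sum: "(\<And>i. i \<in> I \<Longrightarrow> p i \<in> polys e) \<Longrightarrow> sum p I \<in> polys e"
  by (rule subspace_sum[OF subspace_polys])

lemma polys_scaleR: "p \<in> polys e \<Longrightarrow> a *\<^sub>R p \<in> polys e"
  by (rule subspace_scale[OF subspace_polys])

lemma polys_monom: "mdeg \<alpha> \<le> e \<Longrightarrow> monom \<alpha> a \<in> polys e"
  by (rule polysI) (auto simp: lookup_single when_def split: if_splits)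

lemma polys_pconst [simp]: "pconst a \<in> polys e"
  by (rule polys_monom) simp

lemma polys_one [simp]: "1 \<in> polys e"
  using polys_pconst[of 1] by simp

lemma polys_mult: "p \<in> polys a \<Longrightarrow> q \<in> polys b \<Longrightarrow> p * q \<in> polys (a + b)"
  unfolding polys_iff expnts_def
  by (rule order_trans[OF keys_mult]) (fastforce simp: mdeg_add intro: add_mono)

lemma polys_prod_le: "p \<in> polys a \<Longrightarrow> q \<in> polys b \<Longrightarrow> a + b \<le> e \<Longrightarrow> p * q \<in> polys e"
  using polys_mult polys_mono by blast

text \<open>
  For additive statements in which the degree bound matters: the terms of a polynomial obey the same
  bound as the polynomial.
\<close>

lemma polys_induct [consumes 1, case_names single add]:
  fixes p :: "'v::finite rpoly"
  assumes "p \<in> polys e"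
    and "\<And>\<alpha> a. mdeg \<alpha> \<le> e \<Longrightarrow> P (monom \<alpha> a)"
    and "\<And>p q. p \<in> polys e \<Longrightarrow> q \<in> polys e \<Longrightarrow> P p \<Longrightarrow> P q \<Longrightarrow> P (p + q)"
  shows "P p"
proof -
  have "P (\<Sum>\<alpha>\<in>A. monom \<alpha> (coef p \<alpha>)) \<and> (\<Sum>\<alpha>\<in>A. monom \<alpha> (coef p \<alpha>)) \<in> polys e"
    if "finite A" "A \<subseteq> expnts e" for A
    using that
  proof (induction A)
    case empty
    show ?case using assms(2)[of 0 0] subspace_0[OF subspace_polys] by simp
  next
    case (insert \<alpha> A)
    then have \<alpha>: "mdeg \<alpha> \<le> e" by (auto simp: expnts_def)
    let ?r = "\<Sum>\<alpha>\<in>A. monom \<alpha> (coef p \<alpha>)"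
    have r: "P ?r" "?r \<in> polys e" using insert by auto
    have m: "monom \<alpha> (coef p \<alpha>) \<in> polys e" by (rule polys_monom[OF \<alpha>])
    show ?case using insert(1,2) assms(3)[OF m r(2) assms(2)[OF \<alpha>] r(1)] polys_add[OF m r(2)]
      by simp
  qed
  from this[of "Poly_Mapping.keys p"] show ?thesis
    using assms(1) rpoly_eq_sum[of p] by (simp add: polys_iff)
qed

text \<open>
  Evaluation at a point of a commutative ring, along a homomorphism \<open>c\<close> on the coefficients:
  with \<open>c\<close> the identity this is \<open>peval\<close>, with \<open>c = pconst\<close> it is substitution of polynomials.
\<close>

definition phom :: "(real \<Rightarrow> 'b::comm_ring_1) \<Rightarrow> ('v::finite \<Rightarrow> 'b) \<Rightarrow> 'v rpoly \<Rightarrow> 'b" where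
  "phom c \<sigma> p = (\<Sum>\<alpha>\<in>Poly_Mapping.keys p. c (coef p \<alpha>) * (\<Prod>i\<in>UNIV. \<sigma> i ^ coef \<alpha> i))"

text \<open>
  Homomorphisms of unital rings; a predicate, so that \<open>pconst\<close> and the identity on \<open>real\<close> share the
  lemmas below.
\<close>

definition coef_hom :: "(real \<Rightarrow> 'b::comm_ring_1) \<Rightarrow> bool" where
  "coef_hom c \<longleftrightarrow> c 1 = 1 \<and> (\<forall>a b. c (a + b) = c a + c b) \<and> (\<forall>a b. c (a * b) = c a * c b)"

lemma coef_hom_0: "coef_hom c \<Longrightarrow> c 0 = 0"
  by (metis coef_hom_def add_0 add_cancel_right_left)

lemma coef_hom_id: "coef_hom (\<lambda>a. a)"
  by (simp add: coef_hom_def)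

lemma coef_hom_pconst: "coef_hom pconst"
  by (simp add: coef_hom_def single_add mult_single)

context
  fixes c :: "real \<Rightarrow> 'b::comm_ring_1" and \<sigma> :: "'v::finite \<Rightarrow> 'b"
  assumes c: "coef_hom c"
begin

lemma phom_superset:
  assumes "finite A" "Poly_Mapping.keys p \<subseteq> A"
  shows "phom c \<sigma> p = (\<Sum>\<alpha>\<in>A. c (coef p \<alpha>) * (\<Prod>i\<in>UNIV. \<sigma> i ^ coef \<alpha> i))"
  unfolding phom_def using assms
  by (intro sum.mono_neutral_left) (auto simp: in_keys_iff coef_hom_0[OF c])

lemma phom_add: "phom c \<sigma> (p + q) = phom c \<sigma> p + phom c \<sigma> q"
proof -
  let ?A = "Poly_Mapping.keys p \<union> Poly_Mapping.keys q"
  have "phom c \<sigma> (p + q) = (\<Sum>\<alpha>\<in>?A. c (coef (p + q) \<alpha>) * (\<Prod>i\<in>UNIV. \<sigma> i ^ coef \<alpha> i))"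
    by (rule phom_superset) (use keys_add[of p q] in auto)
  also have "\<dots> = phom c \<sigma> p + phom c \<sigma> q"
    using c by (subst (1 2) phom_superset[of ?A])
      (auto simp: lookup_add coef_hom_def distrib_right sum.distrib)
  finally show ?thesis .
qed

lemma phom_monom: "phom c \<sigma> (monom \<alpha> a) = c a * (\<Prod>i\<in>UNIV. \<sigma> i ^ coef \<alpha> i)"
  by (subst phom_superset[of "{\<alpha>}"]) auto

lemma phom_mult: "phom c \<sigma> (p * q) = phom c \<sigma> p * phom c \<sigma> q"
proof (induction p rule: rpoly_induct_single)
  case (single \<alpha> a)
  show ?case
  proof (induction q rule: rpoly_induct_single)
    case (single \<beta> b)
    have "c (a * b) = c a * c b" using c by (simp add: coef_hom_def)
    then show ?case
      by (simp add: mult_single phom_monom lookup_add power_add prod.distrib algebra_simps)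
  qed (simp add: phom_add algebra_simps)
qed (simp add: phom_add algebra_simps)

lemma phom_pconst: "phom c \<sigma> (pconst a) = c a"
  by (simp add: phom_monom)

lemma phom_pvar: "phom c \<sigma> (pvar i) = \<sigma> i"
proof -
  have "(\<Prod>j\<in>UNIV. \<sigma> j ^ coef (expvar i) j) = (\<Prod>j\<in>UNIV. if j = i then \<sigma> i else 1)"
    by (rule prod.cong) (auto simp: lookup_single when_def)
  then show ?thesis using c by (simp add: phom_monom coef_hom_def)
qed

lemma phom_zero: "phom c \<sigma> 0 = 0"
  by (simp add: phom_def)

lemma phom_sum: "phom c \<sigma> (sum p I) = (\<Sum>i\<in>I. phom c \<sigma> (p i))"
  by (induction I rule: infinite_finite_induct) (simp_all add: phom_add phom_zero)

end

lemma peval_eq_phom: "peval q v = phom (\<lambda>a. a) v q"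
  by (simp add: peval_def phom_def mval_def)

lemma peval_add: "peval (p + q) v = peval p v + peval q v"
  by (simp add: peval_eq_phom phom_add[OF coef_hom_id])

lemma peval_mult: "peval (p * q) v = peval p v * peval q v"
  by (simp add: peval_eq_phom phom_mult[OF coef_hom_id])

lemma peval_monom: "peval (monom \<alpha> a) v = a * mval \<alpha> v"
  by (simp add: peval_eq_phom phom_monom[OF coef_hom_id] mval_def)

lemma peval_pconst [simp]: "peval (pconst a) v = a"
  by (simp add: peval_eq_phom phom_pconst[OF coef_hom_id])

lemma peval_pvar [simp]: "peval (pvar i) v = v i"
  by (simp add: peval_eq_phom phom_pvar[OF coef_hom_id])

lemma peval_zero [simp]: "peval 0 v = 0"
  by (simp add: peval_def)

lemma peval_one [simp]: "peval 1 v = 1"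
  using peval_pconst[of 1 v] by simp

lemma peval_sum: "peval (sum p I) v = (\<Sum>i\<in>I. peval (p i) v)"
  by (simp add: peval_eq_phom phom_sum[OF coef_hom_id])

lemma peval_uminus: "peval (- p) v = - peval p v"
  using peval_add[of p "- p" v] by simp

lemma peval_diff: "peval (p - q) v = peval p v - peval q v"
  using peval_add[of p "- q" v] by (simp add: peval_uminus)

lemma peval_superset:
  assumes "finite A" "Poly_Mapping.keys p \<subseteq> A"
  shows "peval p v = (\<Sum>\<alpha>\<in>A. coef p \<alpha> * mval \<alpha> v)"
  using phom_superset[OF coef_hom_id assms] by (simp add: peval_eq_phom mval_def)

lemma pairing_superset:
  assumes "finite A" "Poly_Mapping.keys q \<subseteq> A"
  shows "pairing q y = (\<Sum>\<alpha>\<in>A. coef q \<alpha> * coef y \<alpha>)"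
  unfolding pairing_def using assms
  by (intro sum.mono_neutral_left) (auto simp: in_keys_iff)

lemma pairing_add: "pairing (p + q) y = pairing p y + pairing q y"
proof -
  let ?A = "Poly_Mapping.keys p \<union> Poly_Mapping.keys q"
  have "pairing (p + q) y = (\<Sum>\<alpha>\<in>?A. coef (p + q) \<alpha> * coef y \<alpha>)"
    by (rule pairing_superset) (use keys_add[of p q] in auto)
  also have "\<dots> = pairing p y + pairing q y"
    by (subst (1 2) pairing_superset[of ?A])
      (auto simp: lookup_add distrib_right sum.distrib)
  finally show ?thesis .
qed

lemma pairing_monom: "pairing (monom \<alpha> a) y = a * coef y \<alpha>"
  by (subst pairing_superset[of "{\<alpha>}"]) auto

lemma pairing_zero [simp]: "pairing 0 y = 0"
  by (simp add: pairing_def)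

lemma pairing_scaleR: "pairing (a *\<^sub>R p) y = a * pairing p y"
  by (induction p rule: rpoly_induct_single)
    (simp_all add: scaleR_monom pairing_monom scaleR_add_right pairing_add algebra_simps)

lemma linear_pairing: "linear (\<lambda>p. pairing p y)"
  by (rule linearI) (simp_all add: pairing_add pairing_scaleR)

lemma pairing_sum: "pairing (sum p I) y = (\<Sum>i\<in>I. pairing (p i) y)"
  using linear_sum[OF linear_pairing] .

lemma pairing_diff: "pairing (p - q) y = pairing p y - pairing q y"
  using linear_diff[OF linear_pairing] .

lemma pairing_uminus: "pairing (- p) y = - pairing p y"
  using linear_neg[OF linear_pairing] .

lemma pairing_add_right: "pairing p (y + z) = pairing p y + pairing p z"
  by (simp add: pairing_def lookup_add distrib_left sum.distrib)

lemma pairing_scaleR_right: "pairing p (a *\<^sub>R y) = a * pairing p y"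
  by (simp add: pairing_def sum_distrib_left mult_ac)

lemma pairing_trunc:
  assumes "p \<in> polys e"
  shows "pairing p (trunc e z) = pairing p z"
  using assms unfolding pairing_def
  by (intro sum.cong)
    (auto simp: trunc_def lookup_sum lookup_single when_def polys_iff)

lemma pderivative_superset:
  assumes "finite A" "Poly_Mapping.keys q \<subseteq> A"
  shows "pderivative i q = (\<Sum>\<alpha>\<in>A. monom (\<alpha> - expvar i) (real (coef \<alpha> i) * coef q \<alpha>))"
  unfolding pderivative_def using assms
  by (intro sum.mono_neutral_left) (auto simp: in_keys_iff)

lemma pderivative_monom: "pderivative i (monom \<alpha> a) = monom (\<alpha> - expvar i) (real (coef \<alpha> i) * a)"
  by (subst pderivative_superset[of "{\<alpha>}"]) auto

lemma pderivative_add: "pderivative i (p + q) = pderivative i p + pderivative i q"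
proof -
  let ?A = "Poly_Mapping.keys p \<union> Poly_Mapping.keys q"
  have "pderivative i (p + q) = (\<Sum>\<alpha>\<in>?A. monom (\<alpha> - expvar i) (real (coef \<alpha> i) * coef (p + q) \<alpha>))"
    by (rule pderivative_superset) (use keys_add[of p q] in auto)
  also have "\<dots> = pderivative i p + pderivative i q"
    by (subst (1 2) pderivative_superset[of ?A])
      (auto simp: lookup_add distrib_left sum.distrib single_add)
  finally show ?thesis .
qed

lemma pderivative_pconst [simp]: "pderivative i (pconst a) = 0"
  by (simp add: pderivative_monom)

lemma pderivative_zero [simp]: "pderivative i 0 = 0"
  using pderivative_pconst[of i 0] by simp

lemma coef_pderivative:
  "coef (pderivative i q) \<beta> = real (coef \<beta> i + 1) * coef q (expvar i + \<beta>)"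
proof (induction q rule: rpoly_induct_single)
  case (single \<alpha> a)
  have *: "\<beta> = \<alpha> - expvar i \<longleftrightarrow> \<alpha> = expvar i + \<beta>" if "coef \<alpha> i > 0"
    using expvar_add_diff[OF that] by (metis add_diff_cancel_left')
  show ?case
  proof (cases "coef \<alpha> i = 0")
    case True
    then have "\<alpha> \<noteq> expvar i + \<beta>" by (auto simp: lookup_add)
    then show ?thesis using True by (simp add: pderivative_monom lookup_single)
  next
    case False
    then show ?thesis using * by (auto simp: pderivative_monom lookup_single when_def lookup_add)
  qed
qed (simp add: pderivative_add lookup_add algebra_simps)

lemma pderivative_pvar_mult:
  "pderivative i (pvar j * p) = pvar j * pderivative i p + (if i = j then p else 0)"
proof (induction p rule: rpoly_induct_single)
  case (single \<alpha> a)
  show ?case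
  proof (cases "coef \<alpha> i = 0")
    case True
    then show ?thesis
      by (cases "i = j") (auto simp: mult_single pderivative_monom lookup_add lookup_single_not_eq)
  next
    case False
    have "expvar j + \<alpha> - expvar i = expvar j + (\<alpha> - expvar i)"
      by (rule poly_mapping_eqI) (use False in \<open>auto simp: lookup_add lookup_minus lookup_single when_def\<close>)
    then show ?thesis using False expvar_add_diff[of \<alpha> i]
      by (cases "i = j") (auto simp: mult_single pderivative_monom lookup_add lookup_single_not_eq
          single_add[symmetric] algebra_simps)
  qed
qed (simp add: pderivative_add algebra_simps)

lemma polys_pderivative: "p \<in> polys e \<Longrightarrow> pderivative i p \<in> polys (e - 1)"
proof (rule polysI)
  fix \<beta> assume "p \<in> polys e" "coef (pderivative i p) \<beta> \<noteq> 0"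
  then have "mdeg (expvar i + \<beta>) \<le> e" by (auto simp: coef_pderivative dest: polysD)
  then show "mdeg \<beta> \<le> e - 1" by (simp add: mdeg_add)
qed

lemma polys_0_pconst: "p \<in> polys 0 \<Longrightarrow> p = pconst (coef p 0)"
proof (rule poly_mapping_eqI)
  fix \<alpha> assume "p \<in> polys 0"
  then have "coef p \<alpha> \<noteq> 0 \<Longrightarrow> \<alpha> = 0" using polysD mdeg_eq_0_iff by fastforce
  then show "coef p \<alpha> = coef (pconst (coef p 0)) \<alpha>" by (auto simp: lookup_single when_def)
qed

lemma pderivative_polys_0: "p \<in> polys 0 \<Longrightarrow> pderivative i p = 0"
  using polys_0_pconst pderivative_pconst by metis

lemma zero_in_polys: "0 \<in> polys e"
  by (rule subspace_0[OF subspace_polys])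

section \<open>Eigenvectors of a symmetric form relative to a semidefinite one\<close>

definition orthonormal :: "('a \<Rightarrow> 'a \<Rightarrow> real) \<Rightarrow> 'a set \<Rightarrow> bool" where
  "orthonormal B b \<longleftrightarrow> (\<forall>x\<in>b. \<forall>y\<in>b. B x y = (if x = y then 1 else 0))"

lemma orthonormalD: "orthonormal B b \<Longrightarrow> x \<in> b \<Longrightarrow> y \<in> b \<Longrightarrow> B x y = (if x = y then 1 else 0)"
  by (simp add: orthonormal_def)

text \<open>
  If \<open>B x x = 0\<close> and \<open>B x y \<noteq> 0\<close>, then \<open>B (y + t x) (y + t x)\<close> is affine and not constant in \<open>t\<close>, so
  it takes negative values.
\<close>

lemma null_of_psd:
  fixes B :: "'a::real_vector \<Rightarrow> 'a \<Rightarrow> real"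
  assumes "bilinear B" and sym: "\<And>x y. B x y = B y x" and E: "subspace E"
    and psd: "\<And>x. x \<in> E \<Longrightarrow> 0 \<le> B x x"
    and "x \<in> E" "y \<in> E" and null: "B x x = 0"
  shows "B x y = 0"
proof (rule ccontr)
  assume nz: "B x y \<noteq> 0"
  \<comment> \<open>the affine function of \<open>t\<close> takes the value \<open>-1\<close> here\<close>
  define t where "t = - (B y y + 1) / (2 * B x y)"
  have "y + t *\<^sub>R x \<in> E" using assms by (intro subspace_add subspace_scale)
  then have "0 \<le> B (y + t *\<^sub>R x) (y + t *\<^sub>R x)" by (rule psd)
  also have "\<dots> = B y y + 2 * t * B x y"
    using null sym[of x y]
    by (simp add: bilinear_ladd[OF assms(1)] bilinear_radd[OF assms(1)]
        bilinear_lmul[OF assms(1)] bilinear_rmul[OF assms(1)])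
  also have "\<dots> = -1" using nz by (simp add: t_def field_simps)
  finally show False by simp
qed

lemma orthonormal_finite_card:
  fixes B :: "'a::real_vector \<Rightarrow> 'a \<Rightarrow> real"
  assumes B: "bilinear B" and b: "orthonormal B b" and F: "finite F" "b \<subseteq> span F"
  shows "finite b \<and> card b \<le> card F"
proof (rule independent_span_bound[OF F(1) _ F(2)])
  show "independent b"
    unfolding dependent_explicit
  proof clarify
    fix t u v
    assume t: "finite t" "t \<subseteq> b" "(\<Sum>v\<in>t. u v *\<^sub>R v) = 0" and v: "v \<in> t" "u v \<noteq> 0"
    have lin: "linear (\<lambda>x. B x v)" using B by (simp add: bilinear_def)
    have "0 = B (\<Sum>w\<in>t. u w *\<^sub>R w) v" using t(3) bilinear_lzero[OF B] by simp
    also have "\<dots> = (\<Sum>w\<in>t. u w * B w v)"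
      by (simp add: linear_sum[OF lin] linear_scale[OF lin])
    also have "\<dots> = (\<Sum>w\<in>t. if w = v then u v else 0)"
      using orthonormalD[OF b subsetD[OF t(2)] subsetD[OF t(2) v(1)]] by (intro sum.cong) auto
    also have "\<dots> = u v" using t(1) v(1) by simp
    finally show False using v(2) by simp
  qed
qed

text \<open>
  Orthonormal sets are independent, so their cardinality is bounded by that of a finite spanning
  set. For semidefinite \<open>B\<close> a maximal one spans \<open>E\<close> modulo the kernel.
\<close>

lemma maximal_orthonormal:
  fixes B :: "'a::real_vector \<Rightarrow> 'a \<Rightarrow> real"
  assumes B: "bilinear B" and sym: "\<And>x y. B x y = B y x" and F: "finite F" "E \<subseteq> span F"
  obtains b where "finite b" "b \<subseteq> E" "orthonormal B b"
    "\<And>x. x \<in> E \<Longrightarrow> B x x = 1 \<Longrightarrow> (\<And>y. y \<in> b \<Longrightarrow> B x y = 0) \<Longrightarrow> False"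
proof -
  let ?P = "\<lambda>b. b \<subseteq> E \<and> orthonormal B b"
  have bound: "finite b \<and> card b \<le> card F" if "?P b" for b
    using orthonormal_finite_card[OF B _ F(1)] that F(2) by auto
  have "\<exists>b. ?P b \<and> (\<forall>b'. ?P b' \<longrightarrow> card b' \<le> card b)"
  proof (rule ex_has_greatest_nat)
    show "?P {}" by (simp add: orthonormal_def)
    show "\<forall>b. ?P b \<longrightarrow> card b < Suc (card F)" using bound by (simp add: less_Suc_eq_le)
  qed
  then obtain b where b: "?P b" and max: "\<And>b'. ?P b' \<Longrightarrow> card b' \<le> card b" by blast
  show thesis
  proof (rule that[of b])
    fix x assume x: "x \<in> E" "B x x = 1" and orth: "\<And>y. y \<in> b \<Longrightarrow> B x y = 0"
    have new: "x \<notin> b" using orth[of x] x(2) by auto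
    have "B y z = (if y = z then 1 else 0)" if yz: "y \<in> insert x b" "z \<in> insert x b" for y z
    proof -
      consider "y = x" "z = x" | "y = x" "z \<in> b" | "y \<in> b" "z = x" | "y \<in> b" "z \<in> b"
        using yz by blast
      then show ?thesis
      proof cases
        case 1
        then show ?thesis using x(2) by simp
      next
        case 2
        then show ?thesis using orth[of z] new by auto
      next
        case 3
        then show ?thesis using orth[of y] sym[of y x] new by auto
      next
        case 4
        then show ?thesis using orthonormalD[of B b] b by blast
      qed
    qed
    then have "?P (insert x b)" using b x(1) by (simp add: orthonormal_def)
    from max[OF this] show False using bound[OF b] new by simp
  qed (use b bound[OF b] in auto)
qed

lemma orthonormal_residual:
  fixes B :: "'a::real_vector \<Rightarrow> 'a \<Rightarrow> real"
  assumes B: "bilinear B" and b: "finite b" "orthonormal B b" "z \<in> b"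
  shows "B (x - (\<Sum>y\<in>b. B x y *\<^sub>R y)) z = 0"
proof -
  have lin: "linear (\<lambda>x. B x z)" using B by (simp add: bilinear_def)
  have "B (\<Sum>y\<in>b. B x y *\<^sub>R y) z = (\<Sum>y\<in>b. B x y * B y z)"
    by (simp add: linear_sum[OF lin] linear_scale[OF lin])
  also have "\<dots> = (\<Sum>y\<in>b. if y = z then B x z else 0)"
    using orthonormalD[OF b(2) _ b(3)] by (intro sum.cong) auto
  also have "\<dots> = B x z" using b by simp
  finally show ?thesis by (simp add: linear_diff[OF lin])
qed

text \<open>
  The dimension is the cardinality of a set and not a type, hence the sphere is taken inside the
  product space \<open>'a \<Rightarrow> real\<close>, where Tychonoff's theorem gives compactness.
\<close>

lemma compact_coordinate_sphere:
  assumes "finite b"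
  shows "compact {c :: 'a \<Rightarrow> real. (\<forall>x. x \<notin> b \<longrightarrow> c x = 0) \<and> (\<Sum>x\<in>b. (c x)\<^sup>2) = 1}"
    (is "compact ?S")
proof -
  let ?K = "\<lambda>x. if x \<in> b then {-1..1::real} else {0}"
  have "compactin (product_topology (\<lambda>_. euclidean) UNIV) (PiE UNIV ?K)"
    by (subst compactin_PiE) (auto simp: compactin_euclidean_iff)
  then have "compact (PiE UNIV ?K)"
    by (simp add: euclidean_product_topology compactin_euclidean_iff)
  moreover have "closed ?S"
  proof -
    have "?S = (\<Inter>x\<in>-b. {c. c x = 0}) \<inter> {c. (\<Sum>x\<in>b. (c x)\<^sup>2) = 1}" by auto
    moreover have "closed {c :: 'a \<Rightarrow> real. c x = 0}" for x
      by (rule closed_Collect_eq) auto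
    moreover have "closed {c :: 'a \<Rightarrow> real. (\<Sum>x\<in>b. (c x)\<^sup>2) = 1}"
      by (rule closed_Collect_eq) (intro continuous_on_sum continuous_on_power continuous_on_const
          continuous_on_product_coordinates)+
    ultimately show ?thesis by (auto intro!: closed_Int closed_INT)
  qed
  moreover have "?S \<subseteq> PiE UNIV ?K"
  proof
    fix c assume c: "c \<in> ?S"
    have "\<bar>c x\<bar> \<le> 1" if "x \<in> b" for x
    proof -
      have "(c x)\<^sup>2 \<le> (\<Sum>x\<in>b. (c x)\<^sup>2)" using assms that by (intro member_le_sum) auto
      then show ?thesis using c by (simp add: abs_square_le_1)
    qed
    then show "c \<in> PiE UNIV ?K" using c by (auto simp: abs_le_iff) 
  qed
  ultimately have "compact (PiE UNIV ?K \<inter> ?S)" "PiE UNIV ?K \<inter> ?S = ?S"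
    by (auto intro: compact_Int_closed)
  then show ?thesis by (simp only:)
qed

text \<open>
  A symmetric form that vanishes on the kernel of a semidefinite one attains its largest ratio to
  it; a maximizer is an eigenvector. The maximum is taken over the unit sphere of the coordinates
  in an orthonormal basis of the quotient by the kernel.
\<close>

lemma relative_eigenvector:
  fixes B C :: "'a::real_vector \<Rightarrow> 'a \<Rightarrow> real"
  assumes B: "bilinear B" and symB: "\<And>x y. B x y = B y x"
    and C: "bilinear C" and symC: "\<And>x y. C x y = C y x"
    and E: "subspace E" and F: "finite F" "E \<subseteq> span F"
    and psd: "\<And>x. x \<in> E \<Longrightarrow> 0 \<le> B x x"
    and kernel: "\<And>x y. x \<in> E \<Longrightarrow> y \<in> E \<Longrightarrow> B x x = 0 \<Longrightarrow> C x y = 0"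
    and p: "p \<in> E" "B p p \<noteq> 0"
  obtains x u where "x \<in> E" "B x x = 1" "\<And>y. y \<in> E \<Longrightarrow> C x y = u * B x y"
proof -
  obtain b where b: "finite b" "b \<subseteq> E" "orthonormal B b"
    and max: "\<And>x. x \<in> E \<Longrightarrow> B x x = 1 \<Longrightarrow> (\<And>y. y \<in> b \<Longrightarrow> B x y = 0) \<Longrightarrow> False"
    using maximal_orthonormal[OF B symB F] by metis
  define comb where "comb c = (\<Sum>x\<in>b. c x *\<^sub>R x)" for c :: "'a \<Rightarrow> real"
  have comb_E: "comb c \<in> E" for c
    unfolding comb_def using b E by (intro subspace_sum subspace_scale) auto
  have linr: "linear (B x)" "linear (C x)" and linl: "linear (\<lambda>x. B x y)" "linear (\<lambda>x. C x y)" for x y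
    using B C by (auto simp: bilinear_def)
  have form: "D (comb c) (comb c) = (\<Sum>x\<in>b. \<Sum>y\<in>b. c x * c y * D x y)" if D: "bilinear D"
    for c and D :: "'a \<Rightarrow> 'a \<Rightarrow> real"
  proof -
    have lin: "linear (\<lambda>x. D x y)" "linear (D x)" for x y using D by (auto simp: bilinear_def)
    have 1: "D (comb c) z = (\<Sum>x\<in>b. c x * D x z)" for z
      unfolding comb_def by (simp add: linear_sum[OF lin(1)] linear_scale[OF lin(1)])
    have 2: "D x (comb c) = (\<Sum>y\<in>b. c y * D x y)" for x
      unfolding comb_def by (simp add: linear_sum[OF lin(2)] linear_scale[OF lin(2)])
    show ?thesis
      by (subst 1, intro sum.cong refl) (simp add: 2 sum_distrib_left mult.assoc)
  qed
  have B_comb: "B (comb c) (comb c) = (\<Sum>x\<in>b. (c x)\<^sup>2)" for c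
  proof -
    have "(\<Sum>y\<in>b. c x * c y * B x y) = (c x)\<^sup>2" if "x \<in> b" for x
    proof -
      have "(\<Sum>y\<in>b. c x * c y * B x y) = (\<Sum>y\<in>b. if x = y then (c x)\<^sup>2 else 0)"
        using orthonormalD[OF b(3) that] by (intro sum.cong) (auto simp: power2_eq_square)
      then show ?thesis using b(1) that by simp
    qed
    then show ?thesis by (simp add: form[OF B])
  qed
  have split: "B (x - comb (B x)) (x - comb (B x)) = 0" if x: "x \<in> E" for x
  proof (rule ccontr)
    let ?r = "x - comb (B x)"
    assume nz: "B ?r ?r \<noteq> 0"
    have rE: "?r \<in> E" by (rule subspace_diff[OF E x comb_E])
    have pos: "B ?r ?r > 0" using psd[OF rE] nz by simp
    let ?n = "(1 / sqrt (B ?r ?r)) *\<^sub>R ?r"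
    show False
    proof (rule max[of ?n])
      show "?n \<in> E" by (rule subspace_scale[OF E rE])
      show "B ?n ?n = 1"
        using pos by (simp add: bilinear_lmul[OF B] bilinear_rmul[OF B])
      fix y assume "y \<in> b"
      then have "B ?r y = 0" unfolding comb_def by (rule orthonormal_residual[OF B b(1,3)])
      then show "B ?n y = 0" by (simp add: bilinear_lmul[OF B])
    qed
  qed
  have C_comb: "C x x = C (comb (B x)) (comb (B x))" if x: "x \<in> E" for x
  proof -
    let ?r = "x - comb (B x)"
    have rE: "?r \<in> E" by (rule subspace_diff[OF E x comb_E])
    have z: "C ?r y = 0" if "y \<in> E" for y using kernel[OF rE that split[OF x]] .
    have "C x x = C (comb (B x)) x"
      using z[OF x] by (simp add: linear_diff[OF linl(2)])
    also have "\<dots> = C x (comb (B x))" by (rule symC)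
    also have "\<dots> = C (comb (B x)) (comb (B x))"
      using z[OF comb_E[of "B x"]] by (simp add: linear_diff[OF linl(2)])
    finally show ?thesis .
  qed
  have B_comb': "B x x = (\<Sum>y\<in>b. (B x y)\<^sup>2)" if x: "x \<in> E" for x
  proof -
    let ?r = "x - comb (B x)"
    have rE: "?r \<in> E" by (rule subspace_diff[OF E x comb_E])
    have z: "B ?r y = 0" if "y \<in> E" for y
      by (rule null_of_psd[OF B symB E psd rE that split[OF x]])
    have "B x x = B (comb (B x)) x"
      using z[OF x] by (simp add: linear_diff[OF linl(1)])
    also have "\<dots> = B x (comb (B x))" by (rule symB)
    also have "\<dots> = B (comb (B x)) (comb (B x))"
      using z[OF comb_E[of "B x"]] by (simp add: linear_diff[OF linl(1)])
    finally show ?thesis by (simp add: B_comb)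
  qed
  define S where "S = {c :: 'a \<Rightarrow> real. (\<forall>x. x \<notin> b \<longrightarrow> c x = 0) \<and> (\<Sum>x\<in>b. (c x)\<^sup>2) = 1}"
  have compact_S: "compact S" unfolding S_def by (rule compact_coordinate_sphere[OF b(1)])
  have "b \<noteq> {}" using B_comb'[OF p(1)] p(2) by auto
  then obtain x0 where x0: "x0 \<in> b" by blast
  have "(\<lambda>x. if x = x0 then 1 else 0) \<in> S"
    unfolding S_def using b(1) x0 by (auto simp: if_distrib[of "\<lambda>z. z\<^sup>2"] cong: if_cong)
  then have "S \<noteq> {}" by blast
  moreover have "continuous_on S (\<lambda>c. C (comb c) (comb c))"
    unfolding form[OF C]
    by (intro continuous_on_sum continuous_on_mult continuous_on_const
        continuous_on_subset[OF continuous_on_product_coordinates] subset_UNIV)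
  ultimately have "\<exists>c0\<in>S. \<forall>c\<in>S. C (comb c) (comb c) \<le> C (comb c0) (comb c0)"
    by (rule continuous_attains_sup[OF compact_S])
  then obtain c0 where c0: "c0 \<in> S"
    and c0_max: "\<And>c. c \<in> S \<Longrightarrow> C (comb c) (comb c) \<le> C (comb c0) (comb c0)"
    by blast
  define u where "u = C (comb c0) (comb c0)"
  \<comment> \<open>a semidefinite form with \<open>comb c0\<close> in its kernel; this is the eigenvector equation\<close>
  define P where "P x y = u * B x y - C x y" for x y
  have P: "bilinear P"
    unfolding bilinear_def P_def
    by (intro conjI allI linearI)
      (simp_all add: bilinear_ladd[OF B] bilinear_radd[OF B] bilinear_lmul[OF B] bilinear_rmul[OF B]
        bilinear_ladd[OF C] bilinear_radd[OF C] bilinear_lmul[OF C] bilinear_rmul[OF C] algebra_simps)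
  have symP: "P x y = P y x" for x y unfolding P_def using symB[of x y] symC[of x y] by simp
  have psdP: "0 \<le> P x x" if x: "x \<in> E" for x
  proof (cases "B x x = 0")
    case True
    then show ?thesis using kernel[OF x x] by (simp add: P_def)
  next
    case False
    define n where "n = sqrt (B x x)"
    have n: "n > 0" "n\<^sup>2 = B x x" using False psd[OF x] by (auto simp: n_def)
    define c where "c y = (if y \<in> b then B x y / n else 0)" for y
    have comb_c: "comb c = (1 / n) *\<^sub>R comb (B x)"
      unfolding comb_def c_def by (simp add: scaleR_sum_right)
    have "(\<Sum>y\<in>b. (c y)\<^sup>2) = (\<Sum>y\<in>b. (B x y)\<^sup>2) / n\<^sup>2"
      by (simp add: c_def power_divide sum_divide_distrib)
    then have "(\<Sum>y\<in>b. (c y)\<^sup>2) = 1" using n B_comb'[OF x] by auto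
    then have "c \<in> S" by (simp add: c_def S_def)
    from c0_max[OF this] have "C (comb c) (comb c) \<le> u" by (simp add: u_def)
    then have "C (comb (B x)) (comb (B x)) \<le> u * n\<^sup>2"
      using n(1) by (simp add: comb_c bilinear_lmul[OF C] bilinear_rmul[OF C] power2_eq_square
          field_simps)
    then show ?thesis by (simp add: P_def C_comb[OF x] n)
  qed
  have "B (comb c0) (comb c0) = 1" using c0 by (simp add: B_comb S_def)
  then have null: "P (comb c0) (comb c0) = 0" by (simp add: P_def u_def)
  have "P (comb c0) y = 0" if "y \<in> E" for y
    by (rule null_of_psd[OF P symP E psdP comb_E that null])
  then show thesis
    using that[OF comb_E \<open>B (comb c0) (comb c0) = 1\<close>, of u] by (simp add: P_def)
qed

section \<open>Quadrature for flat functionals\<close>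

text \<open>
  A linear functional that is nonnegative on squares of degree \<open>2 s\<close> and for which every
  polynomial of degree \<open>s\<close> agrees, modulo the kernel of the form \<open>L (p * q)\<close>, with one of the
  smaller degree \<open>r\<close>. For the functional of a truncated moment vector this is the flatness of its
  moment matrix.
\<close>

locale flat_functional =
  fixes L :: "'v::finite rpoly \<Rightarrow> real" and s r :: nat
  assumes linear_L: "linear L"
    and psd: "p \<in> polys s \<Longrightarrow> 0 \<le> L (p * p)"
    and r_less: "r < s"
    and flat: "q \<in> polys s \<Longrightarrow> \<exists>p\<in>polys r. \<forall>v\<in>polys s. L ((q - p) * v) = 0"
begin

definition form :: "'v rpoly \<Rightarrow> 'v rpoly \<Rightarrow> real" where
  "form p q = L (p * q)"

definition null :: "'v rpoly set" where
  "null = {p \<in> polys s. \<forall>q\<in>polys s. L (p * q) = 0}"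

definition shift :: "'v \<Rightarrow> real \<Rightarrow> 'v rpoly" where
  "shift i a = pvar i - pconst a"

lemmas L_add = linear_add[OF linear_L] and L_diff = linear_diff[OF linear_L]
  and L_scale = linear_scale[OF linear_L]

lemma scaleR_mult: "(a *\<^sub>R p) * q = a *\<^sub>R (p * (q :: 'v rpoly))"
  by (simp add: scaleR_eq_pconst_mult mult.assoc)

lemma mult_scaleR: "p * (a *\<^sub>R q) = a *\<^sub>R (p * (q :: 'v rpoly))"
  by (simp add: scaleR_eq_pconst_mult mult_ac)

lemma bilinear_L_mult: "bilinear (\<lambda>p q. L (m * p * q))"
  unfolding bilinear_def
  by (intro conjI allI linearI)
    (simp_all add: distrib_left distrib_right scaleR_mult mult_scaleR L_add L_scale)

lemma bilinear_form: "bilinear form"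
  using bilinear_L_mult[of 1] by (simp add: form_def[abs_def])

lemma form_commute: "form p q = form q p"
  by (simp add: form_def mult.commute)

lemma form_diff_left: "form (p - q) v = form p v - form q v"
  by (simp add: form_def left_diff_distrib L_diff)

lemma form_shift: "form (shift i a * p) q = L (pvar i * p * q) - a * form p q"
  by (simp add: form_def shift_def left_diff_distrib L_diff L_scale
      scaleR_eq_pconst_mult[symmetric] scaleR_mult)

lemma pred_polys: "p \<in> polys (s - 1) \<Longrightarrow> p \<in> polys s"
  using polys_mono by fastforce

lemma pvar_mult_polys: "p \<in> polys (s - 1) \<Longrightarrow> pvar i * p \<in> polys s"
  using r_less by (intro polys_prod_le[of _ 1 _ "s - 1"] polys_monom) auto

lemma shift_mult_polys: "p \<in> polys (s - 1) \<Longrightarrow> shift i a * p \<in> polys s"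
  unfolding shift_def left_diff_distrib
  by (intro polys_diff pvar_mult_polys polys_prod_le[of _ 0 _ "s - 1"]) auto

lemma subspace_null: "subspace null"
proof (rule subspaceI)
  fix p q :: "'v rpoly" and a :: real
  assume "p \<in> null" "q \<in> null"
  then show "p + q \<in> null" by (auto simp: null_def polys_add distrib_right L_add)
next
  fix p :: "'v rpoly" and a :: real
  assume "p \<in> null"
  then show "a *\<^sub>R p \<in> null" by (auto simp: null_def polys_scaleR scaleR_mult L_scale)
qed (simp add: null_def zero_in_polys linear_0[OF linear_L])

lemma nullD: "p \<in> null \<Longrightarrow> q \<in> polys s \<Longrightarrow> form p q = 0"
  by (simp add: null_def form_def)

lemma nullI: "p \<in> polys s \<Longrightarrow> form p p = 0 \<Longrightarrow> p \<in> null"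
  unfolding null_def
  using null_of_psd[OF bilinear_form form_commute subspace_polys, of s p] psd
  by (auto simp: form_def)

lemma reduce:
  assumes "q \<in> polys s"
  obtains p where "p \<in> polys r" "q - p \<in> null"
proof -
  obtain p where p: "p \<in> polys r" "\<forall>v\<in>polys s. L ((q - p) * v) = 0"
    using flat[OF assms] by blast
  have "p \<in> polys s" using polys_mono[OF p(1)] r_less by simp
  then have "q - p \<in> polys s" using assms by (simp add: polys_diff)
  then show thesis using p that by (simp add: null_def)
qed

lemma reduce_pred:
  assumes "q \<in> polys s"
  obtains p where "p \<in> polys (s - 1)" "q - p \<in> null"
proof -
  obtain p where p: "p \<in> polys r" "q - p \<in> null" using reduce[OF assms] .
  have "p \<in> polys (s - 1)" using polys_mono[OF p(1), of "s - 1"] r_less by simp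
  then show thesis using p(2) that by blast
qed

text \<open>
  Degree \<open>s - 1\<close> represents degree \<open>s\<close> modulo the kernel, so that testing against it suffices. As
  \<open>\<langle>x\<^sub>i p, q\<rangle> = \<langle>p, x\<^sub>i q\<rangle>\<close>, and \<open>x\<^sub>i q\<close> is still of degree \<open>s\<close>, it follows that the kernel is stable
  under multiplication by variables as far as the degree permits.
\<close>

lemma null_if_orthogonal_pred:
  assumes "p \<in> polys s" "\<And>q. q \<in> polys (s - 1) \<Longrightarrow> form p q = 0"
  shows "p \<in> null"
proof -
  obtain p' where p': "p' \<in> polys (s - 1)" "p - p' \<in> null" using reduce_pred[OF assms(1)] .
  have "form p p = form p p' + form (p - p') p"
    using form_commute[of p p'] by (simp add: form_diff_left)
  also have "\<dots> = 0" using assms nullD[OF p'(2)] p'(1) by simp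
  finally show ?thesis by (rule nullI[OF assms(1)])
qed

lemma pvar_mult_null:
  assumes "p \<in> null" "p \<in> polys (s - 1)"
  shows "pvar i * p \<in> null"
proof (rule null_if_orthogonal_pred)
  show "pvar i * p \<in> polys s" by (rule pvar_mult_polys[OF assms(2)])
  fix q :: "'v rpoly" assume "q \<in> polys (s - 1)"
  then have "form p (pvar i * q) = 0" by (intro nullD[OF assms(1)] pvar_mult_polys)
  then show "form (pvar i * p) q = 0" by (simp add: form_def mult_ac)
qed

text \<open>
  Subspaces of the quotient by the kernel that are invariant under multiplication by all variables,
  represented by polynomials of degree \<open>s - 1\<close>, for which these products are defined.
\<close>

definition invariant :: "'v rpoly set \<Rightarrow> bool" where
  "invariant E \<longleftrightarrow> subspace E \<and> E \<subseteq> polys (s - 1) \<and>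
     (\<forall>i. \<forall>p\<in>E. \<exists>e\<in>E. pvar i * p - e \<in> null)"

definition nontrivial :: "'v rpoly set \<Rightarrow> bool" where
  "nontrivial E \<longleftrightarrow> (\<exists>p\<in>E. form p p \<noteq> 0)"

lemma shift_mult_invariant:
  assumes E: "invariant E" and p: "p \<in> E"
  obtains e where "e \<in> E" "shift i a * p - e \<in> null"
proof -
  obtain e where e: "e \<in> E" "pvar i * p - e \<in> null"
    using E p unfolding invariant_def by blast
  have "e - a *\<^sub>R p \<in> E" using E e(1) p by (simp add: invariant_def subspace_diff subspace_scale)
  moreover have "shift i a * p - (e - a *\<^sub>R p) = pvar i * p - e"
    by (simp add: shift_def scaleR_eq_pconst_mult algebra_simps)
  ultimately show thesis using that e(2) by metis
qed

lemma polys_span: "(polys e :: 'v rpoly set) \<subseteq> span ((\<lambda>\<alpha>. monom \<alpha> 1) ` expnts e)"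
proof
  fix p :: "'v rpoly" assume p: "p \<in> polys e"
  have "p = (\<Sum>\<alpha>\<in>expnts e. coef p \<alpha> *\<^sub>R monom \<alpha> 1)"
    using p rpoly_eq_sum_superset[of "expnts e" p] by (simp add: polys_iff scaleR_monom)
  also have "\<dots> \<in> span ((\<lambda>\<alpha>. monom \<alpha> 1) ` expnts e)"
    by (intro span_sum span_scale span_base) auto
  finally show "p \<in> span ((\<lambda>\<alpha>. monom \<alpha> 1) ` expnts e)" .
qed

text \<open>
  Multiplication by the variables acts on the quotient by the kernel as a commuting family of
  symmetric operators. An eigenspace of one of them is invariant under the others, so that the
  variables can be treated one after the other.
\<close>

lemma eigenspace_invariant:
  assumes E: "invariant E" and nt: "nontrivial E"
  obtains E' a where "E' \<subseteq> E" "invariant E'" "nontrivial E'"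
    "\<And>p. p \<in> E' \<Longrightarrow> shift i a * p \<in> null"
proof -
  have subE: "subspace E" and E_pred: "E \<subseteq> polys (s - 1)" using E by (auto simp: invariant_def)
  let ?C = "\<lambda>p q. L (pvar i * p * q)"
  obtain p where p: "p \<in> E" "form p p \<noteq> 0" using nt by (auto simp: nontrivial_def)
  obtain x a where x: "x \<in> E" "form x x = 1" and eig: "\<And>y. y \<in> E \<Longrightarrow> ?C x y = a * form x y"
  proof (rule relative_eigenvector[of form ?C E "(\<lambda>\<alpha>. monom \<alpha> 1) ` expnts (s - 1)" p])
    show "E \<subseteq> span ((\<lambda>\<alpha>. monom \<alpha> 1) ` expnts (s - 1))" using E_pred polys_span by blast
    show "0 \<le> form x x" if "x \<in> E" for x
      using psd[OF pred_polys] that E_pred by (auto simp: form_def)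
    show "?C x y = 0" if "x \<in> E" "y \<in> E" "form x x = 0" for x y
    proof -
      have xy: "x \<in> polys (s - 1)" "y \<in> polys (s - 1)" using that E_pred by auto
      then have "pvar i * x \<in> null"
        using pvar_mult_null nullI[OF pred_polys] that(3) by blast
      then show ?thesis using nullD[OF _ pred_polys[OF xy(2)]] by (simp add: form_def)
    qed
    show "bilinear ?C" by (rule bilinear_L_mult)
    show "?C x y = ?C y x" for x y by (simp add: mult_ac)
  qed (use p subE bilinear_form form_commute in auto)
  define E' where "E' = {p \<in> E. shift i a * p \<in> null}"
  have "subspace E'"
  proof (rule subspaceI)
    show "0 \<in> E'" using subspace_0[OF subE] subspace_0[OF subspace_null] by (simp add: E'_def)
  next
    fix p q assume "p \<in> E'" "q \<in> E'"
    then show "p + q \<in> E'"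
      by (simp add: E'_def distrib_left subspace_add[OF subE] subspace_add[OF subspace_null])
  next
    fix p b assume "p \<in> E'"
    then show "b *\<^sub>R p \<in> E'"
      by (simp add: E'_def mult_scaleR subspace_scale[OF subE] subspace_scale[OF subspace_null])
  qed
  moreover have "\<exists>e\<in>E'. pvar j * p - e \<in> null" if p: "p \<in> E'" for j p
  proof -
    have pE: "p \<in> E" and pn: "shift i a * p \<in> null" using p by (auto simp: E'_def)
    obtain e where e: "e \<in> E" "pvar j * p - e \<in> null"
      using E pE unfolding invariant_def by blast
    have "shift i a * e \<in> null"
    proof (rule null_if_orthogonal_pred)
      show "shift i a * e \<in> polys s" using e(1) E_pred shift_mult_polys by blast
      fix q :: "'v rpoly" assume q: "q \<in> polys (s - 1)"
      have "form (shift i a * p) (pvar j * q) = 0"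
        by (rule nullD[OF pn pvar_mult_polys[OF q]])
      moreover have "form (pvar j * p - e) (shift i a * q) = 0"
        by (rule nullD[OF e(2) shift_mult_polys[OF q]])
      moreover have "form (pvar j * p - e) (shift i a * q)
          = form (shift i a * p) (pvar j * q) - form (shift i a * e) q"
        unfolding form_diff_left by (simp add: form_def mult_ac)
      ultimately show "form (shift i a * e) q = 0" by simp
    qed
    then show ?thesis using e by (auto simp: E'_def)
  qed
  ultimately have inv: "invariant E'" using E_pred by (auto simp: invariant_def E'_def)
  have "x \<in> E'"
  proof -
    have sx: "shift i a * x \<in> polys s" using x(1) E_pred shift_mult_polys by blast
    obtain e where e: "e \<in> E" "shift i a * x - e \<in> null" using shift_mult_invariant[OF E x(1)] .
    have e_pred: "e \<in> polys s" using e(1) E_pred pred_polys by blast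
    have orth: "form (shift i a * x) y = 0" if "y \<in> E" for y
      using eig[OF that]
      by (simp add: form_shift)
    have "form e e = form (shift i a * x) e - form (shift i a * x - e) e"
      by (simp add: form_diff_left)
    also have "\<dots> = 0" using orth[OF e(1)] nullD[OF e(2) e_pred] by simp
    finally have "e \<in> null" by (rule nullI[OF e_pred])
    from subspace_add[OF subspace_null e(2) this] show ?thesis
      using x(1) by (simp add: E'_def)
  qed
  then have nt': "nontrivial E'" unfolding nontrivial_def using x(2) by (intro bexI[of _ x]) simp_all
  show thesis by (rule that[OF _ inv nt']) (auto simp: E'_def)
qed

definition eigen :: "('v \<Rightarrow> real) \<Rightarrow> 'v rpoly \<Rightarrow> bool" where
  "eigen u p \<longleftrightarrow> p \<in> polys (s - 1) \<and> (\<forall>i. shift i (u i) * p \<in> null)"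

lemma common_eigenspace:
  assumes "finite I" "invariant E" "nontrivial E"
  shows "\<exists>E'\<subseteq>E. invariant E' \<and> nontrivial E' \<and> (\<exists>u. \<forall>i\<in>I. \<forall>p\<in>E'. shift i (u i) * p \<in> null)"
  using assms(1)
proof (induction I)
  case empty
  show ?case using assms by auto
next
  case (insert i I)
  then obtain E1 u where E1: "E1 \<subseteq> E" "invariant E1" "nontrivial E1"
    "\<forall>j\<in>I. \<forall>p\<in>E1. shift j (u j) * p \<in> null" by blast
  obtain E2 a where E2: "E2 \<subseteq> E1" "invariant E2" "nontrivial E2"
    "\<And>p. p \<in> E2 \<Longrightarrow> shift i a * p \<in> null"
    using eigenspace_invariant[OF E1(2,3)] by metis
  have "\<forall>j\<in>insert i I. \<forall>p\<in>E2. shift j ((u(i := a)) j) * p \<in> null"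
    using E1(4) E2(1,4) insert(2) by auto
  then show ?case using E1(1) E2(1-3) by (intro exI[of _ E2]) blast
qed

lemma common_eigenvector:
  assumes "invariant E" "nontrivial E"
  obtains u p where "p \<in> E" "form p p = 1" "eigen u p"
proof -
  obtain E' u where E': "E' \<subseteq> E" "invariant E'" "nontrivial E'"
    and u: "\<And>i p. p \<in> E' \<Longrightarrow> shift i (u i) * p \<in> null"
    using common_eigenspace[OF finite[of UNIV] assms] by blast
  obtain q where q: "q \<in> E'" "form q q \<noteq> 0" using E'(3) by (auto simp: nontrivial_def)
  have sub: "subspace E'" and E'_pred: "E' \<subseteq> polys (s - 1)" using E'(2) by (auto simp: invariant_def)
  have pos: "form q q > 0" using psd[OF pred_polys, of q] q E'_pred by (auto simp: form_def)
  let ?p = "(1 / sqrt (form q q)) *\<^sub>R q"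
  have p: "?p \<in> E'" by (rule subspace_scale[OF sub q(1)])
  show thesis
  proof (rule that)
    show "?p \<in> E" using p E'(1) by blast
    show "form ?p ?p = 1" using pos
      by (simp add: bilinear_lmul[OF bilinear_form] bilinear_rmul[OF bilinear_form])
    show "eigen u ?p" using p E'_pred u[OF p] by (auto simp: eigen_def)
  qed
qed

text \<open>
  The orthogonal complement of a set of common eigenvectors is invariant. A maximal orthonormal
  set of common eigenvectors therefore spans everything modulo the kernel.
\<close>

lemma complement_invariant:
  assumes "\<forall>x\<in>b. \<exists>u. eigen u x"
  shows "invariant {p \<in> polys (s - 1). \<forall>x\<in>b. form p x = 0}" (is "invariant ?E")
proof -
  have "subspace ?E"
    by (rule subspaceI)
      (auto simp: polys_add polys_scaleR zero_in_polys bilinear_ladd[OF bilinear_form]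
        bilinear_lmul[OF bilinear_form] bilinear_lzero[OF bilinear_form])
  moreover have "\<exists>e\<in>?E. pvar i * p - e \<in> null" if p: "p \<in> ?E" for i p
  proof -
    obtain e where e: "e \<in> polys (s - 1)" "pvar i * p - e \<in> null"
      using reduce_pred[OF pvar_mult_polys] p by blast
    have "form e x = 0" if x: "x \<in> b" for x
    proof -
      obtain u where u: "eigen u x" using assms x by blast
      then have x_pred: "x \<in> polys (s - 1)" by (simp add: eigen_def)
      have "form (pvar i * p - e) x = 0" by (rule nullD[OF e(2) pred_polys[OF x_pred]])
      moreover have "form (shift i (u i) * x) p = 0"
        using u p pred_polys by (intro nullD) (auto simp: eigen_def)
      moreover have "form (shift i (u i) * x) p = form (pvar i * p) x - u i * form p x"
        by (simp add: form_shift) (simp add: form_def mult_ac)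
      ultimately show ?thesis using p x by (simp add: form_diff_left)
    qed
    then show ?thesis using e by blast
  qed
  ultimately show ?thesis by (auto simp: invariant_def)
qed

lemma eigenbasis:
  obtains b u where "finite b" "orthonormal form b" "\<And>x. x \<in> b \<Longrightarrow> eigen (u x) x"
    "\<And>q. q \<in> polys s \<Longrightarrow> q - (\<Sum>x\<in>b. form q x *\<^sub>R x) \<in> null"
proof -
  let ?F = "(\<lambda>\<alpha>. monom \<alpha> 1) ` expnts (s - 1) :: 'v rpoly set"
  let ?P = "\<lambda>b. orthonormal form b \<and> (\<forall>x\<in>b. \<exists>u. eigen u x)"
  have bound: "finite b \<and> card b \<le> card ?F" if "?P b" for b
  proof (rule orthonormal_finite_card[OF bilinear_form])
    show "b \<subseteq> span ?F" using that polys_span by (auto simp: eigen_def)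
  qed (use that in auto)
  have "\<exists>b. ?P b \<and> (\<forall>b'. ?P b' \<longrightarrow> card b' \<le> card b)"
  proof (rule ex_has_greatest_nat)
    show "?P {}" by (simp add: orthonormal_def)
    show "\<forall>b. ?P b \<longrightarrow> card b < Suc (card ?F)" using bound by (simp add: less_Suc_eq_le)
  qed
  then obtain b where b: "orthonormal form b" "\<forall>x\<in>b. \<exists>u. eigen u x"
    and max: "\<And>b'. ?P b' \<Longrightarrow> card b' \<le> card b" by blast
  have fin: "finite b" using bound b by blast
  have b_pred: "b \<subseteq> polys (s - 1)" using b(2) by (auto simp: eigen_def)
  let ?E = "{p \<in> polys (s - 1). \<forall>x\<in>b. form p x = 0}"
  have inv: "invariant ?E" by (rule complement_invariant[OF b(2)])
  have "\<not> nontrivial ?E"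
  proof
    assume "nontrivial ?E"
    from common_eigenvector[OF inv this] obtain u p
      where p: "p \<in> ?E" "form p p = 1" "eigen u p" by blast
    have new: "p \<notin> b" using p(1,2) by auto
    have orth: "form p x = 0" "form x p = 0" if "x \<in> b" for x
      using p(1) that by (simp_all add: form_commute[of x])
    have "form x y = (if x = y then 1 else 0)" if xy: "x \<in> insert p b" "y \<in> insert p b" for x y
    proof -
      consider "x = p" "y = p" | "x = p" "y \<in> b" | "x \<in> b" "y = p" | "x \<in> b" "y \<in> b"
        using xy by blast
      then show ?thesis
        by cases (use p(2) new orth orthonormalD[OF b(1)] in auto)
    qed
    then have "?P (insert p b)" using b(2) p(3) by (auto simp: orthonormal_def)
    from max[OF this] show False using fin new by simp
  qed
  then have trivial: "form p p = 0" if "p \<in> ?E" for p using that by (auto simp: nontrivial_def)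
  have "\<forall>x\<in>b. \<exists>u. eigen u x" by (rule b(2))
  then obtain u where u: "\<And>x. x \<in> b \<Longrightarrow> eigen (u x) x" by metis
  have expand: "q - (\<Sum>x\<in>b. form q x *\<^sub>R x) \<in> null" if q: "q \<in> polys (s - 1)" for q
  proof -
    let ?q = "q - (\<Sum>x\<in>b. form q x *\<^sub>R x)"
    have q_pred: "?q \<in> polys (s - 1)"
      using q b_pred by (intro polys_diff polys_sum polys_scaleR) auto
    have "?q \<in> ?E" using q_pred orthonormal_residual[OF bilinear_form fin b(1)] by simp
    then show ?thesis using nullI[OF pred_polys[OF q_pred]] trivial by blast
  qed
  show thesis
  proof (rule that[OF fin b(1) u])
    fix q :: "'v rpoly" assume "q \<in> polys s"
    then obtain p where p: "p \<in> polys (s - 1)" "q - p \<in> null" using reduce_pred by blast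
    have "form q x = form p x" if "x \<in> b" for x
      using nullD[OF p(2) pred_polys, of x] that b_pred by (auto simp: form_diff_left)
    then have "(\<Sum>x\<in>b. form q x *\<^sub>R x) = (\<Sum>x\<in>b. form p x *\<^sub>R x)" by (intro sum.cong) auto
    moreover have "q - p + (p - (\<Sum>x\<in>b. form p x *\<^sub>R x)) \<in> null"
      by (rule subspace_add[OF subspace_null p(2) expand[OF p(1)]])
    ultimately show "q - (\<Sum>x\<in>b. form q x *\<^sub>R x) \<in> null" by simp
  qed
qed

text \<open>
  On an eigenvector \<open>x\<close> each variable acts as the scalar \<open>u i\<close>, hence a polynomial as its value at \<open>u\<close>.
\<close>

lemma eigen_eval:
  assumes x: "eigen u x" and q: "q \<in> polys s"
  shows "form q x = peval q u * L x"
  using q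
proof (induction q rule: polys_induct)
  case (single \<alpha> a)
  then show ?case
  proof (induction \<alpha> rule: mono_induct)
    case zero
    show ?case by (simp add: form_def scaleR_eq_pconst_mult[symmetric] L_scale)
  next
    case (var i \<alpha>)
    then have deg: "mdeg \<alpha> \<le> s" by (simp add: mdeg_add)
    have "form (shift i (u i) * x) (monom \<alpha> a) = 0"
      using x polys_monom[OF deg] by (intro nullD) (auto simp: eigen_def)
    moreover have "form (shift i (u i) * x) (monom \<alpha> a)
        = form (pvar i * monom \<alpha> a) x - u i * form (monom \<alpha> a) x"
      by (simp add: form_shift) (simp add: form_def mult_ac)
    ultimately have "form (pvar i * monom \<alpha> a) x = u i * peval (monom \<alpha> a) u * L x"
      using var(1)[OF deg] by simp
    also have "\<dots> = peval (pvar i * monom \<alpha> a) u * L x" by (simp add: peval_mult)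
    finally show ?case by (simp only: pvar_mult_monom)
  qed
next
  case (add p q)
  then show ?case by (simp add: bilinear_ladd[OF bilinear_form] peval_add distrib_right)
qed

text \<open>
  The eigenvalues are the nodes of a quadrature formula that represents \<open>L\<close> up to degree \<open>2 s\<close>.
  The eigenvector of a node, represented in degree \<open>r\<close>, interpolates: it vanishes at the other
  nodes. Thus \<open>L (g * p * p) \<ge> 0\<close> for all \<open>p\<close> of degree \<open>r\<close> forces \<open>g\<close> to be nonnegative at the
  nodes.
\<close>

theorem quadrature:
  obtains b :: "'v rpoly set" and u c where "finite b"
    "\<And>x. x \<in> b \<Longrightarrow> c x \<ge> 0"
    "\<And>p. p \<in> polys (2 * s) \<Longrightarrow> L p = (\<Sum>x\<in>b. c x * peval p (u x))"
    "\<And>g x. x \<in> b \<Longrightarrow> (\<And>p. p \<in> polys r \<Longrightarrow> g * p * p \<in> polys (2 * s) \<and> 0 \<le> L (g * p * p))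
       \<Longrightarrow> 0 \<le> peval g (u x)"
proof -
  obtain b u where b: "finite b" "orthonormal form b"
    and eig: "\<And>x. x \<in> b \<Longrightarrow> eigen (u x) x"
    and expand: "\<And>q. q \<in> polys s \<Longrightarrow> q - (\<Sum>x\<in>b. form q x *\<^sub>R x) \<in> null"
    using eigenbasis by blast
  have b_s: "x \<in> polys s" if "x \<in> b" for x
    using eig[OF that] unfolding eigen_def by (blast intro: pred_polys)
  have parseval: "L (q * v) = (\<Sum>x\<in>b. (L x)\<^sup>2 * peval (q * v) (u x))"
    if q: "q \<in> polys s" and v: "v \<in> polys s" for q v
  proof -
    have lin: "linear (\<lambda>p. form p v)" using bilinear_form by (simp add: bilinear_def)
    have "form q v = form (\<Sum>x\<in>b. form q x *\<^sub>R x) v"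
      using nullD[OF expand[OF q] v] by (simp add: form_diff_left)
    also have "\<dots> = (\<Sum>x\<in>b. form q x * form v x)"
      by (subst linear_sum[OF lin], intro sum.cong refl)
        (simp only: bilinear_lmul[OF bilinear_form] real_scaleR_def form_commute[of v])
    also have "\<dots> = (\<Sum>x\<in>b. (L x)\<^sup>2 * peval (q * v) (u x))"
      by (intro sum.cong)
        (auto simp: eigen_eval[OF eig q] eigen_eval[OF eig v] peval_mult power2_eq_square)
    finally show ?thesis by (simp add: form_def)
  qed
  have repr: "L p = (\<Sum>x\<in>b. (L x)\<^sup>2 * peval p (u x))" if "p \<in> polys (2 * s)" for p
    using that
  proof (induction p rule: polys_induct)
    case (single \<alpha> a)
    then have "mdeg \<alpha> \<le> s + s" by simp
    then obtain \<beta> \<gamma> where "\<alpha> = \<beta> + \<gamma>" "mdeg \<beta> \<le> s" "mdeg \<gamma> \<le> s" by (rule mono_split)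
    then show ?case using parseval[OF polys_monom[of \<beta>] polys_monom[of \<gamma>], of a 1]
      by (simp add: mult_single)
  next
    case (add p q)
    then show ?case by (simp add: L_add peval_add distrib_left sum.distrib)
  qed
  show thesis
  proof (rule that[OF b(1) _ repr])
    fix g x assume x: "x \<in> b"
      and g: "\<And>p. p \<in> polys r \<Longrightarrow> g * p * p \<in> polys (2 * s) \<and> 0 \<le> L (g * p * p)"
    obtain p where p: "p \<in> polys r" "x - p \<in> null" using reduce[OF b_s[OF x]] .
    have p_s: "p \<in> polys s" using polys_mono[OF p(1)] r_less by simp
    have delta: "peval p (u y) * L y = (if x = y then 1 else 0)" if y: "y \<in> b" for y
    proof -
      have "form (x - p) y = 0" by (rule nullD[OF p(2) b_s[OF y]])
      then have "form p y = form x y" by (simp add: form_diff_left)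
      then show ?thesis
        using eigen_eval[OF eig[OF y] p_s] orthonormalD[OF b(2) x y] by simp
    qed
    have "L (g * p * p) = (\<Sum>y\<in>b. (L y)\<^sup>2 * peval (g * p * p) (u y))"
      using repr g[OF p(1)] by blast
    also have "\<dots> = (\<Sum>y\<in>b. peval g (u y) * (peval p (u y) * L y)\<^sup>2)"
      by (simp add: peval_mult power2_eq_square mult_ac)
    also have "\<dots> = (\<Sum>y\<in>b. if x = y then peval g (u x) else 0)"
      by (intro sum.cong) (auto simp: delta)
    also have "\<dots> = peval g (u x)" using b(1) x by simp
    finally show "0 \<le> peval g (u x)" using g[OF p(1)] by simp
  qed auto
qed

end

section \<open>Flat truncation of moment vectors\<close>

definition col_on :: "'i set \<Rightarrow> ('i \<Rightarrow> 'i \<Rightarrow> real) \<Rightarrow> 'i \<Rightarrow> ('i \<Rightarrow>\<^sub>0 real)" where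
  "col_on I A j = (\<Sum>i\<in>I. Poly_Mapping.single i (A i j))"

lemma coef_col_on: "finite I \<Longrightarrow> coef (col_on I A j) k = (if k \<in> I then A k j else 0)"
  by (simp add: col_on_def lookup_sum lookup_single when_def)

lemma rank_on_col_on: "rank_on I A = dim (col_on I A ` I)"
  by (simp add: rank_on_def col_on_def[abs_def])

lemma independent_if_image_independent:
  fixes f :: "'a::real_vector \<Rightarrow> 'b::real_vector"
  assumes f: "linear f" and "inj_on f S" "independent (f ` S)"
  shows "independent S"
  unfolding dependent_explicit
proof clarify
  fix t u v assume t: "finite t" "t \<subseteq> S" "(\<Sum>v\<in>t. u v *\<^sub>R v) = 0" and v: "v \<in> t" "u v \<noteq> 0"
  have inj: "inj_on f t" using assms(2) t(2) inj_on_subset by blast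
  define u' where "u' = u \<circ> the_inv_into t f"
  have "(\<Sum>w\<in>f ` t. u' w *\<^sub>R w) = (\<Sum>v\<in>t. u v *\<^sub>R f v)"
    by (simp add: sum.reindex[OF inj] u'_def the_inv_into_f_f[OF inj])
  also have "\<dots> = f (\<Sum>v\<in>t. u v *\<^sub>R v)" by (simp add: linear_sum[OF f] linear_scale[OF f])
  also have "\<dots> = 0" using t(3) linear_0[OF f] by simp
  finally have "(\<Sum>w\<in>f ` t. u' w *\<^sub>R w) = 0" .
  moreover have "u' (f v) \<noteq> 0" using v by (simp add: u'_def the_inv_into_f_f[OF inj])
  ultimately have "dependent (f ` S)"
    unfolding dependent_explicit using t(1,2) v(1)
    by (intro exI[of _ "f ` t"] exI[of _ u']) auto
  then show False using assms(3) by simp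
qed

lemma span_image_sum:
  fixes f :: "'i \<Rightarrow> 'a::real_vector"
  assumes "finite J" "x \<in> span (f ` J)"
  shows "\<exists>a. x = (\<Sum>j\<in>J. a j *\<^sub>R f j)"
proof -
  let ?S = "{x. \<exists>a. x = (\<Sum>j\<in>J. a j *\<^sub>R f j)}"
  have "subspace ?S"
  proof (rule subspaceI)
    show "0 \<in> ?S" by (auto intro!: exI[of _ "\<lambda>_. 0"])
  next
    fix x y assume "x \<in> ?S" "y \<in> ?S"
    then obtain a b where "x = (\<Sum>j\<in>J. a j *\<^sub>R f j)" "y = (\<Sum>j\<in>J. b j *\<^sub>R f j)" by blast
    then have "x + y = (\<Sum>j\<in>J. (a j + b j) *\<^sub>R f j)"
      by (simp add: scaleR_add_left sum.distrib)
    then show "x + y \<in> ?S" by (intro CollectI exI[of _ "\<lambda>j. a j + b j"])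
  next
    fix c x assume "x \<in> ?S"
    then obtain a where "x = (\<Sum>j\<in>J. a j *\<^sub>R f j)" by blast
    then have "c *\<^sub>R x = (\<Sum>j\<in>J. (c * a j) *\<^sub>R f j)" by (simp add: scaleR_sum_right)
    then show "c *\<^sub>R x \<in> ?S" by (intro CollectI exI[of _ "\<lambda>j. c * a j"])
  qed
  moreover have "f j \<in> ?S" if "j \<in> J" for j
  proof -
    have "(\<Sum>i\<in>J. (if i = j then 1 else 0) *\<^sub>R f i) = (\<Sum>i\<in>J. if i = j then f j else 0)"
      by (intro sum.cong) auto
    then have "f j = (\<Sum>i\<in>J. (if i = j then 1 else 0) *\<^sub>R f i)"
      using assms(1) that by simp
    then show ?thesis by (intro CollectI exI[of _ "\<lambda>i. if i = j then 1 else 0"])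
  qed
  ultimately have "span (f ` J) \<subseteq> ?S" by (intro span_minimal) auto
  then show ?thesis using assms(2) by blast
qed

text \<open>
  The columns of the principal submatrix on \<open>J\<close> are the truncations of the columns over \<open>J\<close>. If
  truncation does not lower the rank, the columns over \<open>J\<close> already span all columns.
\<close>

lemma column_combination:
  assumes I: "finite I" "J \<subseteq> I" and rank: "rank_on I A = rank_on J A" and i: "i \<in> I"
  shows "\<exists>a. \<forall>k\<in>I. A k i = (\<Sum>j\<in>J. a j * A k j)"
proof -
  have J: "finite J" using I finite_subset by blast
  define f where "f x = (\<Sum>i\<in>J. Poly_Mapping.single i (coef x i))" for x :: "'a \<Rightarrow>\<^sub>0 real"
  have lin: "linear f"
    by (rule linearI) (simp_all add: f_def lookup_add single_add sum.distrib scaleR_sum_right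
        scaleR_monom)
  have f_col: "f (col_on I A j) = col_on J A j" for j
  proof -
    have "f (col_on I A j) = (\<Sum>i\<in>J. Poly_Mapping.single i (A i j))"
      unfolding f_def using I by (intro sum.cong) (auto simp: coef_col_on)
    then show ?thesis by (simp add: col_on_def)
  qed
  obtain D where D: "D \<subseteq> col_on J A ` J" "independent D" "col_on J A ` J \<subseteq> span D"
    "card D = dim (col_on J A ` J)"
    by (rule basis_exists)
  have "col_on J A ` J = f ` (col_on I A ` J)" by (simp add: image_image f_col)
  then have "D \<subseteq> f ` (col_on I A ` J)" using D(1) by simp
  then obtain C where C: "C \<subseteq> col_on I A ` J" "inj_on f C" "D = f ` C"
    by (auto simp: subset_image_inj)
  have indC: "independent C" using independent_if_image_independent[OF lin C(2)] D(2) C(3) by simp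
  have finC: "finite C" using C(1) J finite_subset by blast
  obtain B where B: "B \<subseteq> col_on I A ` I" "independent B" "col_on I A ` I \<subseteq> span B"
    "card B = dim (col_on I A ` I)"
    by (rule basis_exists)
  have finB: "finite B" using B(1) I(1) finite_subset by blast
  have card: "card C = card B"
    using rank D(4) B(4) C(2,3) by (simp add: rank_on_col_on card_image)
  have "col_on I A i \<in> span C"
  proof (rule ccontr)
    assume out: "col_on I A i \<notin> span C"
    then have new: "col_on I A i \<notin> C" using span_base by blast
    have "independent (insert (col_on I A i) C)" using out indC by (simp add: independent_insert)
    moreover have "insert (col_on I A i) C \<subseteq> span B"
    proof -
      have "C \<subseteq> col_on I A ` I" using C(1) image_mono[OF I(2)] by (rule order_trans)
      then have "insert (col_on I A i) C \<subseteq> col_on I A ` I" using i by simp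
      then show ?thesis using B(3) by (rule order_trans)
    qed
    ultimately have "card (insert (col_on I A i) C) \<le> card B"
      using independent_span_bound[OF finB] by blast
    then show False using new finC card by simp
  qed
  then have "col_on I A i \<in> span (col_on I A ` J)" using span_mono[OF C(1)] by blast
  then obtain a where a: "col_on I A i = (\<Sum>j\<in>J. a j *\<^sub>R col_on I A j)"
    using span_image_sum[OF J] by blast
  have "A k i = (\<Sum>j\<in>J. a j * A k j)" if "k \<in> I" for k
  proof -
    have "coef (col_on I A i) k = (\<Sum>j\<in>J. a j * coef (col_on I A j) k)"
      by (subst a) (simp add: lookup_sum)
    then show ?thesis using that by (simp add: coef_col_on[OF I(1)])
  qed
  then show ?thesis by blast
qed

lemma half_up_le: "e \<le> 2 * half_up e"
  by (simp add: half_up_def)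

lemma half_up_mono: "a \<le> b \<Longrightarrow> half_up a \<le> half_up b"
  by (simp add: half_up_def div_le_mono)

lemma tdeg_ge: "q \<in> set qs \<Longrightarrow> pdeg q \<le> tdeg qs"
  by (simp add: tdeg_def)

lemma pdeg_one [simp]: "pdeg 1 = 0"
  by (simp add: pdeg_def)

lemma loc_idx_one: "loc_idx 1 k = expnts k"
  by (simp add: loc_idx_def expnts_def half_up_def)

lemma loc_entry_one: "loc_entry 1 w \<alpha> \<beta> = coef w (\<alpha> + \<beta>)"
  by (simp add: loc_entry_def mult_single pairing_monom)

lemma pairing_pconst_mult: "pairing (pconst a * p) w = a * pairing p w"
  by (simp add: scaleR_eq_pconst_mult[symmetric] pairing_scaleR)

lemma finite_loc_idx: "finite (loc_idx q k)"
  by (rule finite_subset[OF _ finite_expnts[of k]]) (auto simp: loc_idx_def expnts_def)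

text \<open>The quadratic form of the localizing matrix of \<open>q\<close> is \<open>p \<mapsto> \<langle>q p\<^sup>2, w\<rangle>\<close>.\<close>

lemma loc_psd_pairing:
  assumes psd: "loc_psd q k w" and p: "Poly_Mapping.keys p \<subseteq> loc_idx q k"
  shows "0 \<le> pairing (q * p * p) w"
proof -
  let ?I = "loc_idx q k"
  have p_sum: "p = (\<Sum>\<alpha>\<in>?I. monom \<alpha> (coef p \<alpha>))"
    by (rule rpoly_eq_sum_superset[OF finite_loc_idx p])
  have "q * p * p = (\<Sum>\<alpha>\<in>?I. \<Sum>\<beta>\<in>?I. q * monom \<alpha> (coef p \<alpha>) * monom \<beta> (coef p \<beta>))"
  proof -
    have "p * p = (\<Sum>\<alpha>\<in>?I. \<Sum>\<beta>\<in>?I. monom \<alpha> (coef p \<alpha>) * monom \<beta> (coef p \<beta>))"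
      by (subst (1 2) p_sum) (rule sum_product)
    then show ?thesis by (simp only: mult.assoc sum_distrib_left)
  qed
  also have "\<dots> = (\<Sum>\<alpha>\<in>?I. \<Sum>\<beta>\<in>?I. pconst (coef p \<alpha>) * (pconst (coef p \<beta>) * (q * monom \<alpha> 1 * monom \<beta> 1)))"
  proof (intro sum.cong refl)
    fix \<alpha> \<beta>
    have "monom \<alpha> (coef p \<alpha>) = pconst (coef p \<alpha>) * monom \<alpha> 1"
      "monom \<beta> (coef p \<beta>) = pconst (coef p \<beta>) * monom \<beta> 1" by (simp_all add: mult_single)
    then show "q * monom \<alpha> (coef p \<alpha>) * monom \<beta> (coef p \<beta>)
      = pconst (coef p \<alpha>) * (pconst (coef p \<beta>) * (q * monom \<alpha> 1 * monom \<beta> 1))"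
      by (simp only: mult_ac)
  qed
  finally have eq: "q * p * p
    = (\<Sum>\<alpha>\<in>?I. \<Sum>\<beta>\<in>?I. pconst (coef p \<alpha>) * (pconst (coef p \<beta>) * (q * monom \<alpha> 1 * monom \<beta> 1)))" .
  have "pairing (q * p * p) w
      = (\<Sum>\<alpha>\<in>?I. \<Sum>\<beta>\<in>?I. coef p \<alpha> * loc_entry q w \<alpha> \<beta> * coef p \<beta>)"
    unfolding eq pairing_sum pairing_pconst_mult loc_entry_def by (intro sum.cong refl) simp
  then show ?thesis using psd by (simp add: loc_psd_def psd_on_def)
qed

lemma mom_psd_pairing: "mom_psd k w \<Longrightarrow> p \<in> polys k \<Longrightarrow> 0 \<le> pairing (p * p) w"
  using loc_psd_pairing[of 1 k w p] by (simp add: mom_psd_def loc_idx_one polys_iff)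

text \<open>
  A dependence of the columns of the moment matrix, read as a polynomial, is an element of the
  kernel of the form \<open>\<langle>p q, z\<rangle>\<close>.
\<close>

lemma flat_reduction:
  assumes rank: "mom_rank s z = mom_rank r z" and "r \<le> s" and q: "q \<in> polys s"
  shows "\<exists>p\<in>polys r. \<forall>v\<in>polys s. pairing ((q - p) * v) z = 0"
  using q
proof (induction q rule: polys_induct)
  case (single \<alpha> c)
  have "\<exists>a. \<forall>k\<in>expnts s. loc_entry 1 z k \<alpha> = (\<Sum>j\<in>expnts r. a j * loc_entry 1 z k j)"
  proof (rule column_combination)
    show "rank_on (expnts s) (loc_entry 1 z) = rank_on (expnts r) (loc_entry 1 z)"
      using rank by (simp add: mom_rank_def loc_idx_one)
    show "\<alpha> \<in> expnts s" using single by (simp add: expnts_def)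
  qed (use assms(2) expnts_mono in auto)
  then obtain a where a: "\<And>k. mdeg k \<le> s \<Longrightarrow> coef z (k + \<alpha>) = (\<Sum>j\<in>expnts r. a j * coef z (k + j))"
    by (auto simp: loc_entry_one expnts_def)
  let ?p = "\<Sum>j\<in>expnts r. monom j (a j * c)"
  have "pairing ((monom \<alpha> c - ?p) * v) z = 0" if "v \<in> polys s" for v
    using that
  proof (induction v rule: polys_induct)
    case (single \<beta> b)
    have "(monom \<alpha> c - ?p) * monom \<beta> b
        = monom (\<beta> + \<alpha>) (b * c) - (\<Sum>j\<in>expnts r. monom (\<beta> + j) (b * (a j * c)))"
    proof -
      have "monom k e * monom \<beta> b = monom (\<beta> + k) (b * e)" for k e
        by (simp add: mult_single add.commute mult.commute)
      then show ?thesis by (simp only: left_diff_distrib sum_distrib_right)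
    qed
    then have "pairing ((monom \<alpha> c - ?p) * monom \<beta> b) z
        = b * c * coef z (\<beta> + \<alpha>) - (\<Sum>j\<in>expnts r. b * (a j * c) * coef z (\<beta> + j))"
      by (simp add: pairing_diff pairing_sum pairing_monom)
    also have "\<dots> = 0" by (simp add: a[OF single] sum_distrib_left mult_ac)
    finally show ?case .
  qed (simp add: distrib_left pairing_add)
  moreover have "?p \<in> polys r" by (intro polys_sum polys_monom) (simp add: expnts_def)
  ultimately show ?case by blast
next
  case (add q q')
  then obtain p p' where "p \<in> polys r" "p' \<in> polys r"
    and eq: "\<And>v. v \<in> polys s \<Longrightarrow> pairing ((q - p) * v) z = 0"
      "\<And>v. v \<in> polys s \<Longrightarrow> pairing ((q' - p') * v) z = 0" by blast
  moreover have "pairing ((q + q' - (p + p')) * v) z = 0" if "v \<in> polys s" for v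
  proof -
    have "(q + q' - (p + p')) * v = (q - p) * v + (q' - p') * v" by (simp add: algebra_simps)
    then show ?thesis using eq[OF that] by (simp add: pairing_add)
  qed
  ultimately show ?case by (intro bexI[of _ "p + p'"]) (auto simp: polys_add)
qed

text \<open>
  The gap \<open>d\<close> between the two orders serves twice: being positive, it makes
  the functional flat, and being at least half the degree of each \<open>g\<^sub>i\<close>, it lets the localizing
  matrices reach \<open>g\<^sub>i p\<^sup>2\<close> for the interpolating polynomials \<open>p\<close> of degree \<open>s - d\<close>.
\<close>

theorem flat_truncation:
  fixes z :: "'v::finite tms"
  assumes psd: "mom_psd k z" and loc: "\<forall>q\<in>set g. loc_psd q k z"
    and "s \<le> k" "0 < d" "d \<le> s" and deg: "half_up (tdeg g) \<le> d"
    and rank: "mom_rank s z = mom_rank (s - d) z"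
  obtains b :: "'v rpoly set" and u :: "'v rpoly \<Rightarrow> real^'v" and c where "finite b"
    "\<And>x. x \<in> b \<Longrightarrow> c x \<ge> 0" "\<And>x. x \<in> b \<Longrightarrow> u x \<in> semialg g"
    "\<And>p. p \<in> polys (2 * s) \<Longrightarrow> pairing p z = (\<Sum>x\<in>b. c x * peval p (($) (u x)))"
proof -
  interpret flat_functional "\<lambda>p. pairing p z" s "s - d"
  proof (rule flat_functional.intro)
    show "linear (\<lambda>p. pairing p z)" by (rule linear_pairing)
    show "0 \<le> pairing (p * p) z" if "p \<in> polys s" for p
      using mom_psd_pairing[OF psd] polys_mono[OF that \<open>s \<le> k\<close>] by blast
    show "s - d < s" using assms by simp
    show "\<exists>p\<in>polys (s - d). \<forall>v\<in>polys s. pairing ((q - p) * v) z = 0" if "q \<in> polys s" for q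
      by (rule flat_reduction[OF rank _ that]) simp
  qed
  obtain b :: "'v rpoly set" and u :: "'v rpoly \<Rightarrow> 'v \<Rightarrow> real" and c where b: "finite b"
    "\<And>x. x \<in> b \<Longrightarrow> c x \<ge> 0"
    "\<And>p. p \<in> polys (2 * s) \<Longrightarrow> pairing p z = (\<Sum>x\<in>b. c x * peval p (u x))"
    and node: "\<And>q x. x \<in> b \<Longrightarrow>
       (\<And>p. p \<in> polys (s - d) \<Longrightarrow> q * p * p \<in> polys (2 * s) \<and> 0 \<le> pairing (q * p * p) z)
       \<Longrightarrow> 0 \<le> peval q (u x)"
    by (rule quadrature) blast
  have eval: "($) (\<chi> i. u x i) = u x" for x by auto
  show thesis
  proof (rule that[of b c "\<lambda>x. \<chi> i. u x i"])
    fix x assume x: "x \<in> b"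
    have "0 \<le> peval q (u x)" if q: "q \<in> set g" for q
    proof (rule node[OF x])
      fix p :: "'v rpoly" assume p: "p \<in> polys (s - d)"
      have half: "half_up (pdeg q) \<le> d" using half_up_mono[OF tdeg_ge[OF q]] deg by simp
      have "pdeg q + (s - d) + (s - d) \<le> 2 * s" using half half_up_le[of "pdeg q"] assms by simp
      then have "q * p * p \<in> polys (2 * s)"
        using polys_mult[OF polys_mult[OF polys_pdeg[of q] p] p] polys_mono by blast
      moreover have "Poly_Mapping.keys p \<subseteq> loc_idx q k"
        using p half assms by (auto simp: polys_iff expnts_def loc_idx_def)
      ultimately show "q * p * p \<in> polys (2 * s) \<and> 0 \<le> pairing (q * p * p) z"
        using loc_psd_pairing loc q by blast
    qed
    then show "(\<chi> i. u x i) \<in> semialg g" by (simp add: semialg_def eval)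
  next
    fix p :: "'v rpoly" assume "p \<in> polys (2 * s)"
    then show "pairing p z = (\<Sum>x\<in>b. c x * peval p (($) (\<chi> i. u x i)))"
      unfolding eval by (rule b(3))
  qed (use b in auto)
qed

section \<open>Jensen's inequality for SOS-convex polynomials\<close>

definition sqnorm :: "'v::finite mono \<Rightarrow> nat" where
  "sqnorm \<alpha> = (\<Sum>i\<in>UNIV. (coef \<alpha> i)\<^sup>2)"

text \<open>
  The parallelogram identity: a midpoint of two points of a ball lies on the sphere only if the
  two points coincide.
\<close>

lemma sqnorm_midpoint:
  assumes sum: "\<beta> + \<gamma> = \<alpha> + \<alpha>" and "sqnorm \<beta> \<le> sqnorm \<alpha>" "sqnorm \<gamma> \<le> sqnorm \<alpha>"
  shows "\<beta> = \<alpha>"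
proof (rule poly_mapping_eqI)
  fix i
  have eq: "real (coef \<beta> i) + real (coef \<gamma> i) = 2 * real (coef \<alpha> i)" for i
    using arg_cong[OF sum, of "\<lambda>m. real (coef m i)"] by (simp add: lookup_add)
  have "(\<Sum>i\<in>UNIV. (real (coef \<beta> i) - real (coef \<alpha> i))\<^sup>2)
      = (\<Sum>i\<in>UNIV. ((real (coef \<beta> i))\<^sup>2 + (real (coef \<gamma> i))\<^sup>2) / 2 - (real (coef \<alpha> i))\<^sup>2)"
  proof (rule sum.cong[OF refl])
    fix i
    have g: "real (coef \<gamma> i) = 2 * real (coef \<alpha> i) - real (coef \<beta> i)" using eq[of i] by simp
    show "(real (coef \<beta> i) - real (coef \<alpha> i))\<^sup>2
      = ((real (coef \<beta> i))\<^sup>2 + (real (coef \<gamma> i))\<^sup>2) / 2 - (real (coef \<alpha> i))\<^sup>2"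
      unfolding g by (simp add: power2_eq_square field_simps)
  qed
  also have "\<dots> = (real (sqnorm \<beta>) + real (sqnorm \<gamma>)) / 2 - real (sqnorm \<alpha>)"
    by (simp add: sqnorm_def sum_subtractf sum.distrib sum_divide_distrib[symmetric])
  also have "\<dots> \<le> 0" using assms(2,3) by simp
  finally have "(\<Sum>i\<in>UNIV. (real (coef \<beta> i) - real (coef \<alpha> i))\<^sup>2) \<le> 0" .
  then have "(\<Sum>i\<in>UNIV. (real (coef \<beta> i) - real (coef \<alpha> i))\<^sup>2) = 0"
    by (intro antisym sum_nonneg) auto
  then show "coef \<beta> i = coef \<alpha> i" by (simp add: sum_nonneg_eq_0_iff)
qed

text \<open>
  In a sum of squares the highest terms do not cancel: among the exponents of maximal degree take
  one of maximal Euclidean norm; its double arises in one way only, and its coefficient is a sum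
  of squares.
\<close>

lemma sos_degree:
  fixes q :: "nat \<Rightarrow> 'v::finite rpoly"
  assumes "(\<Sum>l<r. q l * q l) \<in> polys (2 * e)" and "l < r"
  shows "q l \<in> polys e"
proof (rule ccontr)
  assume "q l \<notin> polys e"
  then obtain \<alpha>0 where \<alpha>0: "\<alpha>0 \<in> Poly_Mapping.keys (q l)" "mdeg \<alpha>0 > e"
    using polysI[of "q l" e] by (force simp: in_keys_iff not_le)
  define U where "U = (\<Union>l<r. Poly_Mapping.keys (q l))"
  have U0: "\<alpha>0 \<in> U" unfolding U_def using \<alpha>0(1) assms(2) by blast
  have "finite U" by (simp add: U_def)
  then have U: "finite U" "U \<noteq> {}" "\<alpha>0 \<in> U" using U0 by auto
  define D where "D = Max (mdeg ` U)"
  have D: "mdeg \<beta> \<le> D" if "\<beta> \<in> U" for \<beta> using U that by (simp add: D_def)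
  have De: "D > e" using D[OF U(3)] \<alpha>0(2) by simp
  let ?V = "{\<beta>\<in>U. mdeg \<beta> = D}"
  have "D \<in> mdeg ` U" unfolding D_def using U by (intro Max_in) auto
  then have V: "finite ?V" "?V \<noteq> {}" using U(1) by auto
  obtain \<alpha> where \<alpha>: "\<alpha> \<in> ?V" and \<alpha>_max: "\<And>\<beta>. \<beta> \<in> ?V \<Longrightarrow> sqnorm \<beta> \<le> sqnorm \<alpha>"
  proof -
    have "Max (sqnorm ` ?V) \<in> sqnorm ` ?V" using V by (intro Max_in) auto
    then obtain \<alpha> where "\<alpha> \<in> ?V" "sqnorm \<alpha> = Max (sqnorm ` ?V)" by auto
    then show thesis using that[of \<alpha>] V(1) by simp
  qed
  have unique: "\<beta> = \<alpha>" if "\<beta> \<in> U" "\<gamma> \<in> U" "\<beta> + \<gamma> = \<alpha> + \<alpha>" for \<beta> \<gamma>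
  proof -
    have "mdeg \<beta> + mdeg \<gamma> = D + D" using arg_cong[OF that(3), of mdeg] \<alpha> by (simp add: mdeg_add)
    then have "\<beta> \<in> ?V" "\<gamma> \<in> ?V" using D[OF that(1)] D[OF that(2)] that by auto
    then show ?thesis using sqnorm_midpoint[OF that(3)] \<alpha>_max by blast
  qed
  have square: "coef (q l * q l) (\<alpha> + \<alpha>) = (coef (q l) \<alpha>)\<^sup>2" if l: "l < r" for l
  proof -
    let ?m = "monom \<alpha> (coef (q l) \<alpha>)"
    let ?q = "q l - ?m"
    have keys: "\<beta> \<in> U" "\<beta> \<noteq> \<alpha>" if "\<beta> \<in> Poly_Mapping.keys ?q" for \<beta>
    proof -
      have "coef ?q \<beta> \<noteq> 0" using that by (simp add: in_keys_iff)
      then show "\<beta> \<noteq> \<alpha>" by (auto simp: lookup_minus)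
      then have "coef (q l) \<beta> \<noteq> 0" using \<open>coef ?q \<beta> \<noteq> 0\<close>
        by (simp add: lookup_minus lookup_single_not_eq)
      then show "\<beta> \<in> U" using l by (auto simp: U_def in_keys_iff)
    qed
    have qq: "coef (?q * ?q) (\<alpha> + \<alpha>) = 0"
    proof (rule ccontr)
      assume "coef (?q * ?q) (\<alpha> + \<alpha>) \<noteq> 0"
      then have "\<alpha> + \<alpha> \<in> Poly_Mapping.keys (?q * ?q)" by (simp add: in_keys_iff)
      then obtain \<beta> \<gamma> where \<beta>: "\<beta> \<in> Poly_Mapping.keys ?q" and \<gamma>: "\<gamma> \<in> Poly_Mapping.keys ?q"
        and eq: "\<alpha> + \<alpha> = \<beta> + \<gamma>" using keys_mult[of ?q ?q] by blast
      have "\<beta> = \<alpha>" using unique[OF keys(1)[OF \<beta>] keys(1)[OF \<gamma>]] eq by simp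
      then show False using keys(2)[OF \<beta>] by simp
    qed
    have mq: "coef (?m * ?q) (\<alpha> + \<alpha>) = 0"
    proof (rule ccontr)
      assume "coef (?m * ?q) (\<alpha> + \<alpha>) \<noteq> 0"
      then have "\<alpha> + \<alpha> \<in> Poly_Mapping.keys (?m * ?q)" by (simp add: in_keys_iff)
      then obtain \<beta> \<gamma> where "\<beta> \<in> Poly_Mapping.keys ?m" and \<gamma>: "\<gamma> \<in> Poly_Mapping.keys ?q"
        and eq: "\<alpha> + \<alpha> = \<beta> + \<gamma>" using keys_mult[of ?m ?q] by blast
      then have "\<beta> = \<alpha>" by (simp split: if_splits)
      then show False using keys(2)[OF \<gamma>] eq by simp
    qed
    have "q l * q l = ?m * ?m + (?m * ?q + ?m * ?q) + ?q * ?q" by (simp add: algebra_simps)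
    then have "coef (q l * q l) (\<alpha> + \<alpha>) = coef (?m * ?m) (\<alpha> + \<alpha>)"
      using qq mq by (simp only: lookup_add)
    then show ?thesis by (simp add: mult_single power2_eq_square)
  qed
  obtain l' where l': "l' < r" "coef (q l') \<alpha> \<noteq> 0"
    using \<alpha> by (auto simp: U_def in_keys_iff)
  have "coef (\<Sum>l<r. q l * q l) (\<alpha> + \<alpha>) = (\<Sum>l<r. (coef (q l) \<alpha>)\<^sup>2)"
    by (simp add: lookup_sum square)
  moreover have "(\<Sum>l<r. (coef (q l) \<alpha>)\<^sup>2) > 0"
    using l' by (intro sum_pos2[of _ l']) auto
  ultimately have "mdeg (\<alpha> + \<alpha>) \<le> 2 * e" using polysD[OF assms(1)] by auto
  then show False using \<alpha> De by (simp add: mdeg_add)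
qed

lemma sos_pairing_nonneg:
  fixes q :: "nat \<Rightarrow> 'v::finite rpoly"
  assumes "mom_psd t w" "(\<Sum>l<r. q l * q l) \<in> polys (2 * t)"
  shows "0 \<le> pairing (\<Sum>l<r. q l * q l) w"
  unfolding pairing_sum
  using mom_psd_pairing[OF assms(1) sos_degree[OF assms(2)]] by (intro sum_nonneg) auto

text \<open>Composition with the dilation of ratio \<open>a\<close> about the point \<open>u\<close>.\<close>

definition dilate :: "('v::finite \<Rightarrow> real) \<Rightarrow> real \<Rightarrow> 'v rpoly \<Rightarrow> 'v rpoly" where
  "dilate u a = phom pconst (\<lambda>i. pconst (u i) + pconst a * (pvar i - pconst (u i)))"

lemma dilate_pconst [simp]: "dilate u a (pconst b) = pconst b"
  by (simp add: dilate_def phom_pconst[OF coef_hom_pconst])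

lemma dilate_zero [simp]: "dilate u a 0 = 0"
  using dilate_pconst[of u a 0] by simp

lemma dilate_add: "dilate u a (p + q) = dilate u a p + dilate u a q"
  by (simp add: dilate_def phom_add[OF coef_hom_pconst])

lemma dilate_sum: "dilate u a (sum p I) = (\<Sum>i\<in>I. dilate u a (p i))"
  by (simp add: dilate_def phom_sum[OF coef_hom_pconst])

lemma dilate_mult: "dilate u a (p * q) = dilate u a p * dilate u a q"
  by (simp add: dilate_def phom_mult[OF coef_hom_pconst])

lemma dilate_pvar: "dilate u a (pvar i) = pconst (u i) + pconst a * (pvar i - pconst (u i))"
  by (simp add: dilate_def phom_pvar[OF coef_hom_pconst])

lemma dilate_one: "dilate u 1 p = p"
  by (induction p rule: rpoly_induct) (simp_all add: dilate_add dilate_mult dilate_pvar)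

lemma dilate_by_zero: "dilate u 0 p = pconst (peval p u)"
  by (induction p rule: rpoly_induct)
    (simp_all add: dilate_add dilate_mult dilate_pvar peval_add peval_mult single_add mult_single)

lemma dilate_polys: "p \<in> polys e \<Longrightarrow> dilate u a p \<in> polys e"
proof (induction p rule: polys_induct)
  case (single \<alpha> b)
  have "dilate u a (monom \<alpha> b) \<in> polys (mdeg \<alpha>)"
  proof (induction \<alpha> rule: mono_induct)
    case zero
    show ?case by simp
  next
    case (var i \<alpha>)
    have "dilate u a (pvar i) \<in> polys 1"
      unfolding dilate_pvar
      by (intro polys_add polys_prod_le[of _ 0 _ 1] polys_diff polys_monom) auto
    then have "dilate u a (pvar i * monom \<alpha> b) \<in> polys (1 + mdeg \<alpha>)"
      unfolding dilate_mult using var by (rule polys_mult)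
    then show ?case by (simp add: pvar_mult_monom mdeg_add)
  qed
  then show ?case using polys_mono single by blast
qed (simp add: dilate_add polys_add)

text \<open>
  The chain rule under the functional \<open>\<langle>\<cdot>, w\<rangle>\<close>. The factor \<open>r\<close> makes the induction on \<open>p\<close> work and allows
  a second differentiation.
\<close>

lemma dilate_has_derivative:
  "((\<lambda>a. pairing (r * dilate u a p) w) has_real_derivative
     (\<Sum>i\<in>UNIV. pairing (r * (pvar i - pconst (u i)) * dilate u a (pderivative i p)) w)) (at a)"
proof (induction p arbitrary: r rule: rpoly_induct)
  case (add p q)
  then show ?case
    using DERIV_add[OF add(1)[of r] add(2)[of r]]
    by (simp add: dilate_add pderivative_add distrib_left pairing_add sum.distrib)
next
  case (var j p)
  let ?X = "\<lambda>i. pvar i - pconst (u i)"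
  have eq: "r * dilate u a (pvar j * p)
      = pconst (u j) * (r * dilate u a p) + pconst a * (r * ?X j * dilate u a p)" for a
    by (simp add: dilate_mult dilate_pvar algebra_simps)
  have "((\<lambda>a. pairing (r * dilate u a (pvar j * p)) w) has_real_derivative
      u j * (\<Sum>i\<in>UNIV. pairing (r * ?X i * dilate u a (pderivative i p)) w)
      + (a * (\<Sum>i\<in>UNIV. pairing (r * ?X j * ?X i * dilate u a (pderivative i p)) w)
      + 1 * pairing (r * ?X j * dilate u a p) w)) (at a)"
    unfolding eq pairing_add pairing_pconst_mult
    by (intro DERIV_add DERIV_cmult DERIV_mult' DERIV_ident var)
  also have "u j * (\<Sum>i\<in>UNIV. pairing (r * ?X i * dilate u a (pderivative i p)) w)
      + (a * (\<Sum>i\<in>UNIV. pairing (r * ?X j * ?X i * dilate u a (pderivative i p)) w)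
      + 1 * pairing (r * ?X j * dilate u a p) w)
    = (\<Sum>i\<in>UNIV. pairing (r * ?X i * dilate u a (pvar j * pderivative i p)) w)
      + pairing (r * ?X j * dilate u a p) w"
  proof -
    have "r * ?X i * dilate u a (pvar j * pderivative i p)
      = pconst (u j) * (r * ?X i * dilate u a (pderivative i p))
        + pconst a * (r * ?X j * ?X i * dilate u a (pderivative i p))" for i
      by (simp add: dilate_mult dilate_pvar algebra_simps)
    then show ?thesis
      by (simp add: pairing_add pairing_pconst_mult sum.distrib sum_distrib_left)
  qed
  also have "\<dots> = (\<Sum>i\<in>UNIV. pairing (r * ?X i * dilate u a (pderivative i (pvar j * p))) w)"
  proof -
    have "pairing (r * ?X j * dilate u a p) w
        = (\<Sum>i\<in>UNIV. if i = j then pairing (r * ?X j * dilate u a p) w else 0)" by simp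
    also have "\<dots> = (\<Sum>i\<in>UNIV. pairing (r * ?X i * dilate u a (if i = j then p else 0)) w)"
      by (intro sum.cong) auto
    finally show ?thesis
      by (simp only: pderivative_pvar_mult dilate_add distrib_left pairing_add sum.distrib)
  qed
  finally show ?case .
qed simp

text \<open>
  Jensen's inequality for pseudo-moments. Along the dilations towards the vector \<open>u\<close> of first
  moments, the functional takes the value \<open>\<psi>(u)\<close> at 0 and \<open>\<langle>\<psi>, w\<rangle>\<close> at 1. Its first derivative
  vanishes at 0 because \<open>w\<close> annihilates \<open>x - u\<close>, and its second derivative is the value on
  \<open>(x - u)\<^sup>T \<nabla>\<^sup>2\<psi> (x - u)\<close> at the dilated point, a sum of squares of admissible degree.
\<close>

theorem sos_convex_jensen:
  fixes \<psi> :: "'v::finite rpoly"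
  assumes \<psi>: "\<psi> \<in> polys (2 * t)" and convex: "sos_convex \<psi>"
    and psd: "mom_psd t w" and w0: "coef w 0 = 1"
  shows "peval \<psi> (($) (first_moments w)) \<le> pairing \<psi> w"
proof -
  define u where "u i = coef w (expvar i)" for i
  have u: "($) (first_moments w) = u" by (auto simp: first_moments_def u_def)
  let ?X = "\<lambda>i. pvar i - pconst (u i)"
  define \<phi> where "\<phi> a = pairing (dilate u a \<psi>) w" for a
  define \<phi>' where "\<phi>' a = (\<Sum>i\<in>UNIV. pairing (?X i * dilate u a (pderivative i \<psi>)) w)" for a
  define \<phi>'' where "\<phi>'' a =
    (\<Sum>i\<in>UNIV. \<Sum>j\<in>UNIV. pairing (?X i * ?X j * dilate u a (pderivative j (pderivative i \<psi>))) w)" for a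
  have d1: "(\<phi> has_real_derivative \<phi>' a) (at a)" for a
    using dilate_has_derivative[of 1 u \<psi> w a] by (simp add: \<phi>_def[abs_def] \<phi>'_def)
  have d2: "(\<phi>' has_real_derivative \<phi>'' a) (at a)" for a
    unfolding \<phi>'_def[abs_def] \<phi>''_def by (intro DERIV_sum dilate_has_derivative)
  obtain r :: nat and L where L: "\<And>i j. pderivative i (pderivative j \<psi>) = (\<Sum>l<r. L i l * L j l)"
    using convex unfolding sos_convex_def by blast
  \<comment> \<open>the quadratic form of the Hessian \<open>L L\<^sup>T\<close> is the sum of the squares of the entries of
      \<open>L\<^sup>T (x - u)\<close>\<close>
  have second: "0 \<le> \<phi>'' a" for a
  proof -
    let ?H = "\<Sum>i\<in>UNIV. \<Sum>j\<in>UNIV. ?X i * ?X j * dilate u a (pderivative j (pderivative i \<psi>))"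
    define q where "q l = (\<Sum>i\<in>UNIV. ?X i * dilate u a (L i l))" for l
    have "?H = (\<Sum>i\<in>UNIV. \<Sum>j\<in>UNIV. \<Sum>l<r. (?X i * dilate u a (L i l)) * (?X j * dilate u a (L j l)))"
      by (simp only: L dilate_sum dilate_mult sum_distrib_left mult_ac)
    also have "\<dots> = (\<Sum>i\<in>UNIV. \<Sum>l<r. \<Sum>j\<in>UNIV. (?X i * dilate u a (L i l)) * (?X j * dilate u a (L j l)))"
      by (intro sum.cong refl sum.swap)
    also have "\<dots> = (\<Sum>l<r. \<Sum>i\<in>UNIV. \<Sum>j\<in>UNIV. (?X i * dilate u a (L i l)) * (?X j * dilate u a (L j l)))"
      by (rule sum.swap)
    also have "\<dots> = (\<Sum>l<r. q l * q l)" by (simp only: q_def sum_product)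
    finally have H: "?H = (\<Sum>l<r. q l * q l)" .
    have X: "?X i \<in> polys 1" for i by (intro polys_diff polys_monom) auto
    have "?X i * ?X j * dilate u a (pderivative j (pderivative i \<psi>)) \<in> polys (2 * t)" for i j
    proof (cases t)
      case 0
      then show ?thesis using \<psi> by (simp add: pderivative_polys_0 zero_in_polys)
    next
      case (Suc t')
      have "dilate u a (pderivative j (pderivative i \<psi>)) \<in> polys (2 * t - 1 - 1)"
        by (intro dilate_polys polys_pderivative \<psi>)
      then have "?X i * ?X j * dilate u a (pderivative j (pderivative i \<psi>)) \<in> polys (1 + 1 + (2 * t - 1 - 1))"
        by (intro polys_mult X)
      then show ?thesis using Suc by simp
    qed
    then have "?H \<in> polys (2 * t)" by (intro polys_sum)
    then have "0 \<le> pairing ?H w" unfolding H by (rule sos_pairing_nonneg[OF psd])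
    then show ?thesis by (simp only: \<phi>''_def pairing_sum)
  qed
  have "\<phi>' 0 = 0"
  proof -
    have "pairing (?X i * dilate u 0 (pderivative i \<psi>)) w = 0" for i
    proof -
      have "pairing (?X i) w = 0" by (simp add: pairing_diff pairing_monom u_def w0)
      then show ?thesis by (simp only: dilate_by_zero mult.commute[of "?X i"] pairing_pconst_mult mult_zero_right)
    qed
    then show ?thesis by (simp only: \<phi>'_def sum.neutral_const)
  qed
  then have first: "0 \<le> \<phi>' a" if "0 \<le> a" for a
    using DERIV_nonneg_imp_nondecreasing[OF that, of \<phi>'] d2 second by metis
  have "\<phi> 0 \<le> \<phi> 1"
    by (rule DERIV_nonneg_imp_nondecreasing) (use d1 first in auto)
  then show ?thesis by (simp add: \<phi>_def dilate_one dilate_by_zero pairing_monom w0 u)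
qed

section \<open>Polynomial functions, supports and expectations\<close>

lemma peval_has_partial_derivative:
  "((\<lambda>a. peval p (v(i := a))) has_real_derivative peval (pderivative i p) (v(i := a))) (at a)"
proof (induction p rule: rpoly_induct)
  case (add p q)
  then show ?case by (simp add: peval_add pderivative_add DERIV_add)
next
  case (var j p)
  have "((\<lambda>a. (v(i := a)) j) has_real_derivative (if i = j then 1 else 0)) (at a)"
    by (cases "i = j") auto
  from DERIV_mult'[OF this var] show ?case
    by (cases "i = j") (simp_all add: peval_mult pderivative_pvar_mult peval_add add.commute)
qed simp

lemma polys_0_if_gradient_zero:
  fixes p :: "'v::finite rpoly"
  assumes "\<And>i. pderivative i p = 0"
  shows "p \<in> polys 0"
proof (rule polysI, rule ccontr)
  fix \<alpha> assume \<alpha>: "coef p \<alpha> \<noteq> 0" and "\<not> mdeg \<alpha> \<le> 0"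
  then have "\<exists>i. coef \<alpha> i > 0" by (metis mdeg_def not_gr_zero sum.neutral le_refl)
  then obtain i where i: "coef \<alpha> i > 0" by blast
  have "coef (pderivative i p) (\<alpha> - expvar i) \<noteq> 0"
    using \<alpha> unfolding coef_pderivative expvar_add_diff[OF i] by simp
  then show False using assms by simp
qed

text \<open>
  By induction on the degree: the partial derivatives vanish as functions as well, hence they are
  zero, and the polynomial is constant.
\<close>

lemma peval_zero_imp_zero:
  fixes p :: "'v::finite rpoly"
  assumes "\<And>v. peval p v = 0"
  shows "p = 0"
proof -
  have const: "p = 0" if "p \<in> polys 0" "\<And>v. peval p v = 0" for p :: "'v rpoly"
  proof -
    have p: "p = pconst (coef p 0)" by (rule polys_0_pconst[OF that(1)])
    have "coef p 0 = 0" using that(2)[of "\<lambda>_. 0"] by (subst (asm) p) simp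
    then show ?thesis using p by simp
  qed
  have "p = 0" if "p \<in> polys e" "\<And>v. peval p v = 0" for e
    using that
  proof (induction e arbitrary: p)
    case 0
    then show ?case using const by blast
  next
    case (Suc e)
    have "pderivative i p = 0" for i
    proof (rule Suc.IH)
      show "pderivative i p \<in> polys e" using polys_pderivative[OF Suc.prems(1), of i] by simp
      fix v
      have "((\<lambda>_. 0) has_real_derivative peval (pderivative i p) (v(i := v i))) (at (v i))"
        using peval_has_partial_derivative[of p v i "v i"] Suc.prems(2) by simp
      then show "peval (pderivative i p) v = 0" using DERIV_unique[OF _ DERIV_const] by fastforce
    qed
    then show ?case using const polys_0_if_gradient_zero Suc.prems(2) by blast
  qed
  then show ?thesis using assms polys_pdeg by blast
qed

lemma peval_sos_nonneg: "q \<in> sos e \<Longrightarrow> 0 \<le> peval q v"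
proof -
  assume "q \<in> sos e"
  then obtain qs where q: "q = sum_list (map (\<lambda>q. q * q) qs)" by (auto simp: sos_def)
  show ?thesis unfolding q by (induction qs) (simp_all add: peval_add peval_mult)
qed

lemma peval_QM_nonneg:
  assumes "q \<in> QM g e" and v: "v \<in> semialg g"
  shows "0 \<le> peval q (($) v)"
proof -
  obtain \<sigma>0 \<sigma> where q: "q = \<sigma>0 + (\<Sum>i<length g. g ! i * \<sigma> i)" "\<sigma>0 \<in> sos e"
    "\<forall>i<length g. \<sigma> i \<in> sos (e - pdeg (g ! i))"
    using assms(1) by (auto simp: QM_def)
  have "0 \<le> peval (g ! i) (($) v) * peval (\<sigma> i) (($) v)" if "i < length g" for i
    using v q(3) that by (intro mult_nonneg_nonneg) (auto simp: semialg_def intro: peval_sos_nonneg)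
  then show ?thesis
    unfolding q(1) peval_add peval_sum peval_mult
    by (intro add_nonneg_nonneg sum_nonneg peval_sos_nonneg[OF q(2)]) auto
qed

lemma continuous_peval: "continuous_on UNIV (\<lambda>v :: real^'v. peval q (($) v))"
  unfolding peval_def mval_def by (intro continuous_intros)

lemma closed_semialg: "closed (semialg g)"
proof -
  have "semialg g = (\<Inter>q\<in>set g. {v. 0 \<le> peval q (($) v)})" by (auto simp: semialg_def)
  then show ?thesis
    by (auto intro!: closed_INT closed_Collect_le continuous_peval continuous_on_const)
qed

text \<open>
  By second countability the complement of the support is a countable union of null open sets.
\<close>

lemma AE_in_closed_superset_of_support:
  fixes \<mu> :: "'a::second_countable_topology measure"
  assumes \<mu>: "sets \<mu> = sets borel" and S: "closed S" "msupport \<mu> \<subseteq> S"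
  shows "AE x in \<mu>. x \<in> S"
proof -
  let ?F = "{U. open U \<and> emeasure \<mu> U = 0}"
  obtain F where F: "F \<subseteq> ?F" "countable F" "\<Union>F = \<Union>?F"
    using Lindelof[of ?F] by auto
  have "\<Union>F \<in> null_sets \<mu>"
  proof -
    have "(\<Union>U\<in>F. U) \<in> null_sets \<mu>"
      using F(1,2) \<mu> by (intro null_sets_UN') (auto simp: null_sets_def)
    then show ?thesis by simp
  qed
  moreover have "x \<in> \<Union>F" if "x \<notin> S" for x
  proof -
    have "x \<notin> msupport \<mu>" using that S(2) by blast
    then obtain U where "open U" "x \<in> U" "\<not> emeasure \<mu> U > 0" by (auto simp: msupport_def)
    then show ?thesis unfolding F(3) by (auto simp: not_less)
  qed
  ultimately show ?thesis
    by (intro AE_I'[of "\<Union>F"]) auto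
qed

lemma coef_moment_vector:
  "coef (moment_vector e \<mu>) \<beta> = (if \<beta> \<in> expnts e then \<integral>\<xi>. mval \<beta> (($) \<xi>) \<partial>\<mu> else 0)"
  by (simp add: moment_vector_def lookup_sum lookup_single when_def)

lemma pairing_moment_vector:
  assumes p: "p \<in> polys e" and int: "\<forall>\<beta>\<in>expnts e. integrable \<mu> (\<lambda>\<xi>. mval \<beta> (($) \<xi>))"
  shows "pairing p (moment_vector e \<mu>) = (\<integral>\<xi>. peval p (($) \<xi>) \<partial>\<mu>)"
proof -
  have keys: "Poly_Mapping.keys p \<subseteq> expnts e" using p by (simp add: polys_iff)
  have "(\<integral>\<xi>. peval p (($) \<xi>) \<partial>\<mu>)
      = (\<Sum>\<beta>\<in>expnts e. coef p \<beta> * (\<integral>\<xi>. mval \<beta> (($) \<xi>) \<partial>\<mu>))"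
    using int by (simp add: peval_superset[OF finite_expnts keys])
  then show ?thesis by (simp add: pairing_superset[OF finite_expnts keys] coef_moment_vector)
qed

text \<open>
  The expectation only sees the support, where \<open>p\<close> is nonnegative; integrability of \<open>p\<close> comes from
  its degree.
\<close>

lemma pairing_moment_vector_nonneg:
  assumes \<mu>: "\<mu> \<in> ambiguity g e Y" and p: "p \<in> polys e"
    and nonneg: "\<And>v. v \<in> semialg g \<Longrightarrow> 0 \<le> peval p (($) v)"
  shows "0 \<le> pairing p (moment_vector e \<mu>)"
proof -
  have "AE v in \<mu>. v \<in> semialg g"
    using \<mu> by (intro AE_in_closed_superset_of_support closed_semialg) (auto simp: ambiguity_def)
  then have "AE v in \<mu>. 0 \<le> peval p (($) v)" by eventually_elim (rule nonneg)
  then have "0 \<le> (\<integral>v. peval p (($) v) \<partial>\<mu>)" by (rule integral_nonneg_AE)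
  then show ?thesis using \<mu> p by (simp add: pairing_moment_vector ambiguity_def)
qed

text \<open>\<open>xpart\<close> and \<open>xipart\<close> invert \<open>join\<close>.\<close>

definition xpart :: "('n::finite + 'p::finite) mono \<Rightarrow> 'n mono" where
  "xpart m = (\<Sum>i\<in>UNIV. Poly_Mapping.single i (coef m (Inl i)))"

definition xipart :: "('n::finite + 'p::finite) mono \<Rightarrow> 'p mono" where
  "xipart m = (\<Sum>j\<in>UNIV. Poly_Mapping.single j (coef m (Inr j)))"

lemma coef_xpart [simp]: "coef (xpart m) i = coef m (Inl i)"
  by (simp add: xpart_def lookup_sum lookup_single when_def)

lemma coef_xipart [simp]: "coef (xipart m) j = coef m (Inr j)"
  by (simp add: xipart_def lookup_sum lookup_single when_def)

lemma coef_join [simp]: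
  "coef (join \<alpha> \<beta>) (Inl i) = coef \<alpha> i" "coef (join \<alpha> \<beta>) (Inr j) = coef \<beta> j"
  by (simp_all add: join_def lookup_add lookup_sum lookup_single when_def)

lemma join_parts: "join (xpart m) (xipart m) = m"
proof (rule poly_mapping_eqI)
  fix k show "coef (join (xpart m) (xipart m)) k = coef m k" by (cases k) auto
qed

lemma inj_join: "inj_on (\<lambda>(\<alpha>, \<beta>). join \<alpha> \<beta>) A"
proof (rule inj_onI, clarify)
  fix \<alpha> \<beta> \<alpha>' \<beta>' assume eq: "join \<alpha> \<beta> = join \<alpha>' \<beta>'"
  have "coef \<alpha> i = coef \<alpha>' i" for i using arg_cong[OF eq, of "\<lambda>m. coef m (Inl i)"] by simp
  moreover have "coef \<beta> j = coef \<beta>' j" for j using arg_cong[OF eq, of "\<lambda>m. coef m (Inr j)"] by simp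
  ultimately show "\<alpha> = \<alpha>' \<and> \<beta> = \<beta>'" by (auto intro: poly_mapping_eqI)
qed

lemma mval_join: "mval (join \<alpha> \<beta>) (case_sum v w) = mval \<alpha> v * mval \<beta> w"
  by (simp add: mval_def UNIV_Plus_UNIV[symmetric] prod.Plus del: UNIV_Plus_UNIV)

lemma mdeg_xpart: "m \<in> Poly_Mapping.keys h \<Longrightarrow> mdeg (xpart m) \<le> degx h"
  by (auto simp: mdeg_def degx_def intro!: Max_ge)

lemma mdeg_xipart: "m \<in> Poly_Mapping.keys h \<Longrightarrow> mdeg (xipart m) \<le> degxi h"
  by (auto simp: mdeg_def degxi_def intro!: Max_ge)

text \<open>The monomial vector \<open>[v]\<^sub>e\<close>, on which \<open>Hw_poly\<close> and \<open>pairing\<close> are plain evaluation.\<close>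

definition mono_vec :: "nat \<Rightarrow> ('v::finite \<Rightarrow> real) \<Rightarrow> 'v tms" where
  "mono_vec e v = (\<Sum>\<alpha>\<in>expnts e. Poly_Mapping.single \<alpha> (mval \<alpha> v))"

lemma coef_mono_vec: "coef (mono_vec e v) \<alpha> = (if \<alpha> \<in> expnts e then mval \<alpha> v else 0)"
  by (simp add: mono_vec_def lookup_sum lookup_single when_def)

lemma pairing_mono_vec:
  assumes "p \<in> polys e"
  shows "pairing p (mono_vec e v) = peval p v"
proof -
  have "Poly_Mapping.keys p \<subseteq> expnts e" using assms by (simp add: polys_iff)
  then show ?thesis
    by (simp add: pairing_superset[OF finite_expnts] peval_superset[OF finite_expnts] coef_mono_vec)
qed

lemma Hw_poly_polys: "Hw_poly h e w \<in> polys (degxi h)"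
  unfolding Hw_poly_def by (intro polys_sum polys_monom) (simp add: expnts_def)

lemma yH_poly_polys: "yH_poly h e y \<in> polys e"
  unfolding yH_poly_def by (intro polys_sum polys_monom) (simp add: expnts_def)

text \<open>Both sides are the bilinear form \<open>y\<^sup>T H w\<close>.\<close>

lemma pairing_yH_eq_pairing_Hw: "pairing (yH_poly h e y) w = pairing (Hw_poly h e w) y"
proof -
  have "pairing (yH_poly h e y) w
      = (\<Sum>\<alpha>\<in>expnts e. \<Sum>\<beta>\<in>expnts (degxi h). coef y \<beta> * Hmat h \<beta> \<alpha> * coef w \<alpha>)"
    by (simp add: yH_poly_def pairing_sum pairing_monom sum_distrib_right)
  also have "\<dots> = (\<Sum>\<beta>\<in>expnts (degxi h). \<Sum>\<alpha>\<in>expnts e. coef y \<beta> * Hmat h \<beta> \<alpha> * coef w \<alpha>)"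
    by (rule sum.swap)
  also have "\<dots> = pairing (Hw_poly h e w) y"
    by (simp add: Hw_poly_def pairing_sum pairing_monom sum_distrib_left sum_distrib_right
        mult_ac)
  finally show ?thesis .
qed

lemma hval_eq_peval:
  assumes "degx h \<le> e"
  shows "hval h x \<xi> = peval (Hw_poly h e (mono_vec e (($) x))) (($) \<xi>)"
proof -
  let ?J = "\<lambda>(\<alpha>, \<beta>). join \<alpha> \<beta>"
  let ?A = "expnts e \<times> expnts (degxi h)"
  have "Poly_Mapping.keys h \<subseteq> ?J ` ?A"
  proof
    fix m assume m: "m \<in> Poly_Mapping.keys h"
    have "(xpart m, xipart m) \<in> ?A"
      using mdeg_xpart[OF m] mdeg_xipart[OF m] assms by (simp add: expnts_def)
    then show "m \<in> ?J ` ?A" by (rule rev_image_eqI) (simp add: join_parts)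
  qed
  then have "hval h x \<xi> = (\<Sum>m\<in>?J ` ?A. coef h m * mval m (case_sum (($) x) (($) \<xi>)))"
    unfolding hval_def by (intro peval_superset) auto
  also have "\<dots> = (\<Sum>(\<alpha>, \<beta>)\<in>?A. coef h (join \<alpha> \<beta>) * (mval \<alpha> (($) x) * mval \<beta> (($) \<xi>)))"
    by (subst sum.reindex[OF inj_join]) (auto simp: mval_join intro!: sum.cong)
  also have "\<dots> = (\<Sum>\<alpha>\<in>expnts e. \<Sum>\<beta>\<in>expnts (degxi h).
      coef h (join \<alpha> \<beta>) * (mval \<alpha> (($) x) * mval \<beta> (($) \<xi>)))"
    by (rule sum.cartesian_product[symmetric])
  also have "\<dots> = (\<Sum>\<beta>\<in>expnts (degxi h). \<Sum>\<alpha>\<in>expnts e.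
      coef h (join \<alpha> \<beta>) * (mval \<alpha> (($) x) * mval \<beta> (($) \<xi>)))"
    by (rule sum.swap)
  also have "\<dots> = peval (Hw_poly h e (mono_vec e (($) x))) (($) \<xi>)"
    by (simp add: Hw_poly_def peval_sum peval_monom coef_mono_vec Hmat_def sum_distrib_left
        sum_distrib_right mult_ac)
  finally show ?thesis .
qed

lemma integral_hval:
  assumes "\<mu> \<in> ambiguity g (degxi h) Y" "degx h \<le> e"
  shows "(\<integral>\<xi>. hval h x \<xi> \<partial>\<mu>)
    = pairing (Hw_poly h e (mono_vec e (($) x))) (moment_vector (degxi h) \<mu>)"
  using assms by (simp add: hval_eq_peval[OF assms(2)] pairing_moment_vector[OF Hw_poly_polys]
      ambiguity_def)

lemma integral_hval_eq_peval:
  assumes "\<mu> \<in> ambiguity g (degxi h) Y" "degx h \<le> e"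
  shows "(\<integral>\<xi>. hval h x \<xi> \<partial>\<mu>) = peval (yH_poly h e (moment_vector (degxi h) \<mu>)) (($) x)"
  by (simp add: integral_hval[OF assms] pairing_yH_eq_pairing_Hw[symmetric]
      pairing_mono_vec[OF yH_poly_polys])

section \<open>Optimality of the output\<close>

lemma convex_cone_pairing_nonneg: "convex_cone {y. 0 \<le> pairing q y}"
  unfolding convex_cone_def convex_def conic_def
  by (auto simp: pairing_add_right pairing_scaleR_right intro!: add_nonneg_nonneg)
    (auto simp: pairing_def intro!: exI[of _ 0])

lemma pairing_nonneg_on_cone:
  assumes "\<And>y. y \<in> T \<Longrightarrow> 0 \<le> pairing q y" "y \<in> convex_cone hull T"
  shows "0 \<le> pairing q y"
proof -
  have "convex_cone hull T \<subseteq> {y. 0 \<le> pairing q y}"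
    using assms(1) by (intro hull_minimal convex_cone_pairing_nonneg) auto
  then show ?thesis using assms(2) by blast
qed

lemma dro_feasible_iff:
  "x \<in> dro_feasible h c g Y \<longleftrightarrow>
     x \<in> semialg c \<and> (\<forall>\<mu>\<in>ambiguity g (degxi h) Y. 0 \<le> (\<integral>\<xi>. hval h x \<xi> \<partial>\<mu>))"
  by (auto simp: dro_feasible_def le_INF_iff)

lemma half_up_ord_t:
  "half_up (degx h) \<le> ord_t f h c" "half_up (pdeg f) \<le> ord_t f h c"
  "half_up (tdeg c) \<le> ord_t f h c"
  by (simp_all add: ord_t_def)

lemma le_double_if_half_up_le: "half_up e \<le> t \<Longrightarrow> e \<le> 2 * t"
  using half_up_le[of e] by linarith

text \<open>
  Every constraint passes from the pseudo-moments to the point of first moments by Jensen's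
  inequality, applied to \<open>-c\<^sub>i\<close> and, for each measure, to the negative of the expectation of \<open>h\<close>.
\<close>

lemma first_moments_dro_feasible:
  assumes w: "w \<in> primal_feasible f h c g Y k"
    and convex: "\<forall>q\<in>set c. sos_convex (- q)"
    and concave: "\<forall>\<mu>\<in>ambiguity g (degxi h) Y. sos_concave_fun (\<lambda>x. \<integral>\<xi>. hval h x \<xi> \<partial>\<mu>)"
  shows "first_moments w \<in> dro_feasible h c g Y"
proof -
  define t where "t = ord_t f h c"
  have Hw: "Hw_poly h (2 * t) w \<in> (QM g (2 * k) \<inter> polys (degxi h)) + dual_cone (degxi h) Y"
    and loc: "\<forall>q\<in>set c. loc_psd q t w" and psd: "mom_psd t w" and w0: "coef w 0 = 1"
    using w by (auto simp: primal_feasible_def Let_def t_def)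
  have degx: "degx h \<le> 2 * t" unfolding t_def by (rule le_double_if_half_up_le[OF half_up_ord_t(1)])
  have "0 \<le> peval q (($) (first_moments w))" if q: "q \<in> set c" for q
  proof -
    have half: "half_up (pdeg q) \<le> t"
      using half_up_mono[OF tdeg_ge[OF q]] half_up_ord_t(3)[of c f h] by (simp add: t_def)
    have "0 \<le> pairing (q * 1 * 1) w"
      using loc q half by (intro loc_psd_pairing[of q t]) (auto simp: loc_idx_def)
    moreover have "peval (- q) (($) (first_moments w)) \<le> pairing (- q) w"
    proof (rule sos_convex_jensen[OF _ _ psd w0])
      show "- q \<in> polys (2 * t)"
        using le_double_if_half_up_le[OF half] by (intro subspace_neg[OF subspace_polys]) (simp add: polys_def)
      show "sos_convex (- q)" using convex q by blast
    qed
    ultimately show ?thesis by (simp add: peval_uminus pairing_uminus)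
  qed
  moreover have "0 \<le> (\<integral>\<xi>. hval h (first_moments w) \<xi> \<partial>\<mu>)"
    if \<mu>: "\<mu> \<in> ambiguity g (degxi h) Y" for \<mu>
  proof -
    let ?m = "moment_vector (degxi h) \<mu>"
    let ?\<psi> = "yH_poly h (2 * t) ?m"
    obtain \<psi> where \<psi>: "\<And>x. (\<integral>\<xi>. hval h x \<xi> \<partial>\<mu>) = peval \<psi> (($) x)" "sos_convex (- \<psi>)"
      using concave \<mu> unfolding sos_concave_fun_def sos_concave_def by blast
    have "peval (\<psi> - ?\<psi>) v = 0" for v
    proof -
      have "v = ($) (\<chi> i. v i)" by auto
      then show ?thesis
        using \<psi>(1)[of "\<chi> i. v i"] integral_hval_eq_peval[OF \<mu> degx, of "\<chi> i. v i"]
        by (simp add: peval_diff)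
    qed
    \<comment> \<open>equality of the polynomials, because the inequality is about coefficients and needs the
        degree of \<open>?\<psi>\<close>\<close>
    then have eq: "\<psi> = ?\<psi>" using peval_zero_imp_zero[of "\<psi> - ?\<psi>"] by simp
    have "- ?\<psi> \<in> polys (2 * t)"
      by (intro subspace_neg[OF subspace_polys] yH_poly_polys)
    then have "peval (- ?\<psi>) (($) (first_moments w)) \<le> pairing (- ?\<psi>) w"
      using \<psi>(2) unfolding eq by (rule sos_convex_jensen[OF _ _ psd w0])
    moreover have "0 \<le> pairing (Hw_poly h (2 * t) w) ?m"
    proof -
      \<comment> \<open>the two parts are nonnegative on the support of \<open>\<mu>\<close> and on \<open>Y\<close>, respectively\<close>
      obtain p q where pq: "Hw_poly h (2 * t) w = p + q" "p \<in> QM g (2 * k)" "p \<in> polys (degxi h)"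
        "q \<in> dual_cone (degxi h) Y"
        using Hw by (auto elim: set_plus_elim)
      have "0 \<le> pairing p ?m"
        using pairing_moment_vector_nonneg[OF \<mu> pq(3)] peval_QM_nonneg[OF pq(2)] by blast
      moreover have "0 \<le> pairing q ?m" using pq(4) \<mu> by (simp add: dual_cone_def ambiguity_def)
      ultimately show ?thesis by (simp add: pq(1) pairing_add)
    qed
    ultimately show ?thesis
      by (simp add: integral_hval_eq_peval[OF \<mu> degx] peval_uminus pairing_uminus
          pairing_yH_eq_pairing_Hw)
  qed
  ultimately show ?thesis by (simp add: dro_feasible_iff semialg_def)
qed

text \<open>
  For a feasible \<open>x\<close> the polynomial \<open>h(x, \<cdot>)\<close> lies in
  \<open>K\<^sup>*\<close>. Both parts of its decomposition pair nonnegatively with \<open>y\<close>: the part from \<open>Y\<^sup>*\<close> because \<open>y\<close>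
  is in the cone of \<open>Y\<close>, the part that is nonnegative on \<open>S\<close> because flatness gives \<open>y\<close> a quadrature
  formula with nodes in \<open>S\<close>. Hence \<open>f(x) - \<gamma> \<ge> y\<^sup>T H [x] \<ge> 0\<close>.
\<close>

lemma dual_bound:
  fixes h :: "('n::finite + 'p::finite) rpoly"
  assumes dual: "(\<gamma>, y, z) \<in> dual_feasible f h c g Y k"
    and ext: "z' \<in> ext_feasible g (degxi h) k1 y" and flat: "flat h g k1 z'"
    and K: "dual_cone (degxi h) (K_cone g (degxi h) Y)
           = nonneg_polys (degxi h) (semialg g) + dual_cone (degxi h) Y"
    and x: "x \<in> dro_feasible h c g Y"
  shows "\<gamma> \<le> peval f (($) x)"
proof -
  define t where "t = ord_t f h c"
  let ?d = "degxi h"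
  have degx: "degx h \<le> 2 * t" unfolding t_def by (rule le_double_if_half_up_le[OF half_up_ord_t(1)])
  have qm: "f - yH_poly h (2 * t) y - monom 0 \<gamma> \<in> QM c (2 * t)" and y: "y \<in> convex_cone hull Y"
    using dual by (auto simp: dual_feasible_def Let_def t_def)
  let ?hx = "Hw_poly h (2 * t) (mono_vec (2 * t) (($) x))"
  have "0 \<le> pairing ?hx m" if "m \<in> K_cone g ?d Y" for m
    using that unfolding K_cone_def
  proof (rule pairing_nonneg_on_cone[rotated])
    fix m assume "m \<in> moment_vector ?d ` ambiguity g ?d Y"
    then obtain \<mu> where \<mu>: "\<mu> \<in> ambiguity g ?d Y" "m = moment_vector ?d \<mu>" by blast
    have "0 \<le> (\<integral>\<xi>. hval h x \<xi> \<partial>\<mu>)" using x \<mu>(1) by (simp add: dro_feasible_iff)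
    then show "0 \<le> pairing ?hx m" unfolding integral_hval[OF \<mu>(1) degx] \<mu>(2) .
  qed
  then have "?hx \<in> dual_cone ?d (K_cone g ?d Y)" by (simp add: dual_cone_def Hw_poly_polys)
  then obtain p q where pq: "?hx = p + q" "p \<in> nonneg_polys ?d (semialg g)" "q \<in> dual_cone ?d Y"
    unfolding K by (auto elim: set_plus_elim)
  have "0 \<le> pairing p y"
  proof -
    obtain s where s: "ord_d0 h g \<le> s" "ord_d2 g \<le> s" "s \<le> k1"
      "mom_rank s z' = mom_rank (s - ord_d2 g) z'"
      using flat by (auto simp: flat_def)
    have psd: "mom_psd k1 z'" "\<forall>q\<in>set g. loc_psd q k1 z'" and y': "trunc ?d z' = y"
      using ext by (auto simp: ext_feasible_def)
    obtain b :: "'p rpoly set" and u :: "'p rpoly \<Rightarrow> real^'p" and e where b: "finite b"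
      "\<And>x. x \<in> b \<Longrightarrow> e x \<ge> 0" "\<And>x. x \<in> b \<Longrightarrow> u x \<in> semialg g"
      "\<And>p. p \<in> polys (2 * s) \<Longrightarrow> pairing p z' = (\<Sum>x\<in>b. e x * peval p (($) (u x)))"
      by (rule flat_truncation[OF psd s(3) _ s(2) _ s(4)]) (auto simp: ord_d2_def)
    have p: "p \<in> polys ?d" "\<And>v. v \<in> semialg g \<Longrightarrow> 0 \<le> peval p (($) v)"
      using pq(2) by (auto simp: nonneg_polys_def)
    have "?d \<le> 2 * s" using half_up_le[of ?d] s(1) by (simp add: ord_d0_def)
    then have "pairing p y = (\<Sum>x\<in>b. e x * peval p (($) (u x)))"
      using b(4)[OF polys_mono[OF p(1)]] pairing_trunc[OF p(1), of z'] y' by simp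
    also have "\<dots> \<ge> 0" using b p(2) by (intro sum_nonneg mult_nonneg_nonneg) auto
    finally show ?thesis .
  qed
  moreover have "0 \<le> pairing q y"
    using pq(3) by (intro pairing_nonneg_on_cone[OF _ y]) (simp add: dual_cone_def)
  ultimately have "0 \<le> pairing ?hx y" by (simp add: pq(1) pairing_add)
  then have "0 \<le> peval (yH_poly h (2 * t) y) (($) x)"
    by (simp add: pairing_yH_eq_pairing_Hw[symmetric] pairing_mono_vec[OF yH_poly_polys])
  moreover have "0 \<le> peval (f - yH_poly h (2 * t) y - monom 0 \<gamma>) (($) x)"
    using x by (intro peval_QM_nonneg[OF qm]) (simp add: dro_feasible_iff)
  ultimately show ?thesis by (simp add: peval_diff)
qed

definition certified ::
    "'n::finite rpoly \<Rightarrow> ('n + 'p::finite) rpoly \<Rightarrow> 'n rpoly list \<Rightarrow> 'p rpoly list \<Rightarrow> 'p tms set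
      \<Rightarrow> nat \<Rightarrow> 'n tms \<Rightarrow> bool" where
  "certified f h c g Y k w \<longleftrightarrow> primal_optimizer f h c g Y k w \<and>
     (\<exists>\<gamma> y z k1 z'. dual_optimizer f h c g Y k (\<gamma>, y, z) \<and>
        z' \<in> ext_feasible g (degxi h) k1 y \<and> flat h g k1 z')"

text \<open>What a configuration records about the steps that led to it.\<close>

fun config_inv ::
    "'n::finite rpoly \<Rightarrow> ('n + 'p::finite) rpoly \<Rightarrow> 'n rpoly list \<Rightarrow> 'p rpoly list \<Rightarrow> 'p tms set
      \<Rightarrow> ('n, 'p) config \<Rightarrow> bool" where
  "config_inv f h c g Y (Step1 k k1) \<longleftrightarrow> True"
| "config_inv f h c g Y (Step2 k k1 w y) \<longleftrightarrow> primal_optimizer f h c g Y k w \<and>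
     (\<exists>\<gamma> z. dual_optimizer f h c g Y k (\<gamma>, y, z))"
| "config_inv f h c g Y (Step3 k k1 w y z') \<longleftrightarrow> primal_optimizer f h c g Y k w \<and>
     (\<exists>\<gamma> z. dual_optimizer f h c g Y k (\<gamma>, y, z)) \<and> z' \<in> ext_feasible g (degxi h) k1 y"
| "config_inv f h c g Y (Step4 k w) \<longleftrightarrow> certified f h c g Y k w"
| "config_inv f h c g Y (Output k x) \<longleftrightarrow> (\<exists>w. x = first_moments w \<and> certified f h c g Y k w)"

lemma reachable_config_inv: "reachable f h c g Y R s \<Longrightarrow> config_inv f h c g Y s"
proof (induction rule: reachable.induct)
  case (extend k k1 w y z)
  then show ?case by (auto simp: ext_optimizer_def)
next
  case (flat_found k k1 w y z)
  then show ?case by (auto simp: certified_def)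
qed auto

lemma primal_value_optimizer:
  "primal_optimizer f h c g Y k w \<Longrightarrow> primal_value f h c g Y k = ereal (pairing f w)"
  unfolding primal_value_def primal_optimizer_def
  by (intro antisym INF_lower INF_greatest) auto

lemma dual_value_optimizer:
  "dual_optimizer f h c g Y k s \<Longrightarrow> dual_value f h c g Y k = ereal (fst s)"
  unfolding dual_value_def dual_optimizer_def
  by (intro antisym SUP_upper SUP_least) auto

theorem theorem4p3:
  fixes f :: "'n::finite rpoly"
    and h :: "('n + 'p::finite) rpoly"
    and c :: "'n rpoly list"
    and g :: "'p rpoly list"
    and Y :: "'p tms set"
    and R :: "'p rpoly"
    and k :: nat
    and xopt :: "real^'n"
  assumes "conic_described (degxi h) Y"
    and "dual_cone (degxi h) (K_cone g (degxi h) Y)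
           = nonneg_polys (degxi h) (semialg g) + dual_cone (degxi h) Y"
    and "primal_value f h c g Y k = dual_value f h c g Y k"
    and "sos_convex f"
    and "\<forall>q\<in>set c. sos_convex (- q)"
    and "\<forall>\<mu>\<in>ambiguity g (degxi h) Y. sos_concave_fun (\<lambda>x. \<integral>\<xi>. hval h x \<xi> \<partial>\<mu>)"
    and "R \<in> sos (2 * init_k1 h)"
    and "reachable f h c g Y R (Output k xopt)"
  shows "dro_optimizer f h c g Y xopt"
proof -
  obtain w \<gamma> y z k1 z' where xopt: "xopt = first_moments w"
    and w: "primal_optimizer f h c g Y k w"
    and dual: "dual_optimizer f h c g Y k (\<gamma>, y, z)"
    and ext: "z' \<in> ext_feasible g (degxi h) k1 y" and flat: "flat h g k1 z'"
    using reachable_config_inv[OF assms(8)] by (auto simp: certified_def)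
  have wf: "w \<in> primal_feasible f h c g Y k" using w by (simp add: primal_optimizer_def)
  have feasible: "xopt \<in> dro_feasible h c g Y"
    unfolding xopt by (rule first_moments_dro_feasible[OF wf assms(5,6)])
  have "pairing f w = \<gamma>"
    using assms(3) primal_value_optimizer[OF w] dual_value_optimizer[OF dual] by simp
  moreover have "peval f (($) xopt) \<le> pairing f w"
    unfolding xopt
  proof (rule sos_convex_jensen[OF _ assms(4)])
    show "f \<in> polys (2 * ord_t f h c)"
      using le_double_if_half_up_le[OF half_up_ord_t(2)[of f h c]] by (simp add: polys_def)
    show "mom_psd (ord_t f h c) w" "coef w 0 = 1"
      using wf by (auto simp: primal_feasible_def Let_def)
  qed
  moreover have "\<gamma> \<le> peval f (($) x)" if "x \<in> dro_feasible h c g Y" for x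
    using dual_bound[OF _ ext flat assms(2) that] dual by (auto simp: dual_optimizer_def)
  ultimately show ?thesis using feasible by (force simp: dro_optimizer_def)
qed

end
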